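(* Let $F_X$ be a $d$-dimensional generalized inner product distribution with signature $(p,q)$, let $X_1,X_2,\dots$ be i.i.d. with distribution $F_X$, let $X\sim F_X$, and suppose $\mathbf{\Delta}:=\mathbb{E}[XX^{\top}]$ is such that $\mathbf{\Delta}\mathbf{I}_{p,q}$ is full-rank. For each $n$ let $\mathbf{Q_X}$ be the $d\times d$ matrix with $\mathbf{U_P}|\mathbf{\Lambda_P}|^{1/2}\mathbf{Q_X}=\mathbf{X}$. Let $\tilde{\mathbf{\Lambda}}$ be the diagonal matrix of eigenvalues of $\mathbf{\Delta}^{1/2}\mathbf{I}_{p,q}\mathbf{\Delta}^{1/2}$, ordered from largest to smallest. Let $\tilde{\mathbf{Q}}$ be a deterministic limiting matrix of $\mathbf{Q_X}$, in the sense that $\|\mathbf{W}_n\mathbf{Q_X}-\tilde{\mathbf{Q}}\|\to0$ almost surely for some sequence of (random) orthogonal matrices $\mathbf{W}_n$ that are block-orthogonal in the repeated eigenvalues, i.e. commute with $\tilde{\mathbf{\Lambda}}$ (if $\mathbf{\Delta}\mathbf{I}_{p,q}$ has distinct eigenvalues, the $\mathbf{W}_n$ are diagonal sign matrices and this is the limit of $\mathbf{Q_X}$ itself for suitable signs of the eigenvectors). Then $\tilde{\mathbf{Q}}$ must be of the form $$\tilde{\mathbf{Q}}=|\tilde{\mathbf{\Lambda}}|^{-1/2}\tilde{\mathbf{V}}^{\top}\mathbf{\Delta}^{1/2},$$ where $\tilde{\mathbf{V}}$ is an orthogonal matrix of eigenvectors with $\mathbf{\Delta}^{1/2}\mathbf{I}_{p,q}\mathbf{\Delta}^{1/2}=\tilde{\mathbf{V}}\tilde{\mathbf{\Lambda}}\tilde{\mathbf{V}}^{\top}$.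 Here $\tilde{\mathbf{Q}}$ is defined only up to the choice of such a $\tilde{\mathbf{V}}$, the nonuniqueness of which corresponds to repeated eigenvalues of $\mathbf{\Delta}\mathbf{I}_{p,q}$.
   Context: Let $d=p+q$ and $\mathbf{I}_{p,q}:=\mathrm{diag}(\mathbf{I}_p,-\mathbf{I}_q)$, where $\mathbf{I}_r$ is the $r\times r$ identity. A distribution $F_X$ on $\mathbb{R}^d$ is a $d$-dimensional generalized inner product distribution with signature $(p,q)$ if it takes values in a set $\Omega\subset\mathbb{R}^d$ with $x^{\top}\mathbf{I}_{p,q}y\in[0,1]$ for all $x,y\in\Omega$. $\|\cdot\|$ is the spectral norm, and $|\cdot|$ of a diagonal matrix is the entrywise absolute value. For each $n$, $\mathbf{X}$ is the $n\times d$ matrix whose $i$-th row is $X_i^{\top}$, and $\mathbf{P}:=\mathbf{X}\mathbf{I}_{p,q}\mathbf{X}^{\top}$. When $\mathbf{X}$ has rank $d$ (which holds almost surely for all large $n$ if $\mathbf{\Delta}$ is invertible), write the eigendecomposition restricted to the $d$ nonzero eigenvalues as $\mathbf{P}=\mathbf{U_P}\mathbf{\Lambda_P}\mathbf{U_P}^{\top}$, where $\mathbf{\Lambda_P}$ is the $d\times d$ diagonal matrix of nonzero eigenvalues of $\mathbf{P}$ ordered from largest to smallest (so the $p$ positive ones come first) and $\mathbf{U_P}$ is $n\times d$ with orthonormal columns. The matrix $\mathbf{Q_X}$ depends on $n$. *)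

theory Defs
  imports
    "HOL-Probability.Probability"
    "Jordan_Normal_Form.Char_Poly"
    "Jordan_Normal_Form.DL_Rank"
begin

unbundle no inner_syntax and no vec_syntax

section \<open>Matrices\<close>

definition sig_mat :: "nat \<Rightarrow> nat \<Rightarrow> real mat" where
  "sig_mat p q = diag_block_mat [1\<^sub>m p, - 1\<^sub>m q]"

definition spectral_norm :: "real mat \<Rightarrow> real" where
  "spectral_norm A =
     (SUP v \<in> {v \<in> carrier_vec (dim_col A). v \<bullet> v \<le> 1}. sqrt ((A *\<^sub>v v) \<bullet> (A *\<^sub>v v)))"

definition psd_mat :: "real mat \<Rightarrow> bool" where
  "psd_mat A \<longleftrightarrow> A \<in> carrier_mat (dim_row A) (dim_row A) \<and> transpose_mat A = A \<and>
     (\<forall>v \<in> carrier_vec (dim_row A). 0 \<le> v \<bullet> (A *\<^sub>v v))"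

text \<open>The positive semidefinite square root; well defined only if \<open>A\<close> is positive semidefinite.\<close>

definition psd_sqrt :: "real mat \<Rightarrow> real mat" where
  "psd_sqrt A = (THE S. psd_mat S \<and> S * S = A)"

text \<open>\<open>|L|\<close> to the power \<open>r\<close>, meant for diagonal \<open>L\<close> without zero entries on the diagonal.\<close>

definition abs_diag_powr :: "real mat \<Rightarrow> real \<Rightarrow> real mat" where
  "abs_diag_powr L r = mat_diag (dim_row L) (\<lambda>i. \<bar>L $$ (i, i)\<bar> powr r)"

definition ordered_diag :: "nat \<Rightarrow> real mat \<Rightarrow> bool" where
  "ordered_diag d L \<longleftrightarrow> L \<in> carrier_mat d d \<and> diagonal_mat L \<and>
     (\<forall>i j. i \<le> j \<longrightarrow> j < d \<longrightarrow> L $$ (j, j) \<le> L $$ (i, i))"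

text \<open>\<open>L\<close> lists all eigenvalues of \<open>A\<close>, with multiplicity, from largest to smallest.\<close>

definition eigenvalue_mat :: "real mat \<Rightarrow> real mat \<Rightarrow> bool" where
  "eigenvalue_mat A L \<longleftrightarrow> ordered_diag (dim_row A) L \<and>
     char_poly A = (\<Prod>i<dim_row A. [:- L $$ (i, i), 1:])"

text \<open>The library predicate \<open>orthogonal_mat\<close> does not normalise the columns, so it is not used.\<close>

definition orthonormal_cols :: "nat \<Rightarrow> nat \<Rightarrow> real mat \<Rightarrow> bool" where
  "orthonormal_cols n d U \<longleftrightarrow> U \<in> carrier_mat n d \<and> transpose_mat U * U = 1\<^sub>m d"

definition eigenvector_mat :: "real mat \<Rightarrow> real mat \<Rightarrow> real mat \<Rightarrow> bool" where
  "eigenvector_mat A L V \<longleftrightarrow> orthonormal_cols (dim_row A) (dim_row A) V \<and>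
     A = V * L * transpose_mat V"

text \<open>Orthogonal and commuting with the diagonal matrix \<open>L\<close>, i.e. block-orthogonal in the
  repeated diagonal entries of \<open>L\<close>.\<close>

definition block_orthogonal :: "real mat \<Rightarrow> real mat \<Rightarrow> bool" where
  "block_orthogonal L W \<longleftrightarrow> orthonormal_cols (dim_row L) (dim_row L) W \<and> W * L = L * W"

definition sign_mat :: "nat \<Rightarrow> real mat \<Rightarrow> bool" where
  "sign_mat d S \<longleftrightarrow> (\<exists>s. (\<forall>i<d. s i \<in> {1, -1}) \<and> S = mat_diag d s)"


section \<open>Distributions on \<open>d\<close>-dimensional vectors\<close>

text \<open>Real vectors of dimension \<open>d\<close> with the Borel \<open>\<sigma>\<close>-algebra, transported along the
  bijection with the product space of \<open>d\<close> copies of the reals.\<close>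

definition vec_borel :: "nat \<Rightarrow> real vec measure" where
  "vec_borel d = vimage_algebra (carrier_vec d) (\<lambda>v. \<lambda>i\<in>{..<d}. v $ i)
     (PiM {..<d} (\<lambda>_. borel))"

definition gen_inner_product_distribution :: "nat \<Rightarrow> nat \<Rightarrow> real vec measure \<Rightarrow> bool" where
  "gen_inner_product_distribution p q F \<longleftrightarrow>
     prob_space F \<and> sets F = sets (vec_borel (p + q)) \<and>
     (\<exists>\<Omega> \<subseteq> carrier_vec (p + q).
        (\<forall>x\<in>\<Omega>. \<forall>y\<in>\<Omega>. x \<bullet> (sig_mat p q *\<^sub>v y) \<in> {0..1}) \<and> (AE x in F. x \<in> \<Omega>))"

definition has_second_moments :: "nat \<Rightarrow> real vec measure \<Rightarrow> bool" where
  "has_second_moments d F \<longleftrightarrow> (\<forall>i<d. \<forall>j<d. integrable F (\<lambda>x. x $ i * x $ j))"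

definition second_moment_mat :: "nat \<Rightarrow> real vec measure \<Rightarrow> real mat" where
  "second_moment_mat d F = mat d d (\<lambda>(i, j). \<integral>x. x $ i * x $ j \<partial>F)"


section \<open>Spectral embedding\<close>

definition data_mat :: "nat \<Rightarrow> (nat \<Rightarrow> 'w \<Rightarrow> real vec) \<Rightarrow> nat \<Rightarrow> 'w \<Rightarrow> real mat" where
  "data_mat d X n \<omega> = mat_of_rows d (map (\<lambda>i. X i \<omega>) [0..<n])"

definition nonzero_eigendecomposition ::
    "nat \<Rightarrow> real mat \<Rightarrow> real mat \<Rightarrow> real mat \<Rightarrow> bool" where
  "nonzero_eigendecomposition d P U L \<longleftrightarrow>
     orthonormal_cols (dim_row P) d U \<and> ordered_diag d L \<and> (\<forall>i<d. L $$ (i, i) \<noteq> 0) \<and>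
     P = U * L * transpose_mat U"

text \<open>\<open>U\<close>, \<open>L\<close> are the eigenvectors and nonzero eigenvalues of \<open>A I\<^sub>p\<^sub>q A\<^sup>T\<close> and \<open>Q\<close> aligns the
  embedding \<open>U |L|\<^sup>1\<^sup>/\<^sup>2\<close> with \<open>A\<close>. Nothing is required of them while \<open>A\<close> does not have rank
  \<open>p + q\<close>.\<close>

definition embedding_alignment ::
    "nat \<Rightarrow> nat \<Rightarrow> real mat \<Rightarrow> real mat \<Rightarrow> real mat \<Rightarrow> real mat \<Rightarrow> bool" where
  "embedding_alignment p q A U L Q \<longleftrightarrow>
     (vec_space.rank (dim_row A) A = p + q \<longrightarrow>
        nonzero_eigendecomposition (p + q) (A * sig_mat p q * transpose_mat A) U L \<and>
        Q \<in> carrier_mat (p + q) (p + q) \<and>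
        U * abs_diag_powr L (1/2) * Q = A)"

definition as_limit :: "'w measure \<Rightarrow> (nat \<Rightarrow> 'w \<Rightarrow> real mat) \<Rightarrow> real mat \<Rightarrow> bool" where
  "as_limit M Q Q' \<longleftrightarrow> (AE \<omega> in M. (\<lambda>n. spectral_norm (Q n \<omega> - Q')) \<longlonglongrightarrow> 0)"

definition limiting_matrix ::
    "'w measure \<Rightarrow> real mat \<Rightarrow> (nat \<Rightarrow> 'w \<Rightarrow> real mat) \<Rightarrow> real mat \<Rightarrow> bool" where
  "limiting_matrix M L Q Q' \<longleftrightarrow>
     Q' \<in> carrier_mat (dim_row L) (dim_row L) \<and>
     (\<exists>W. (\<forall>n. \<forall>\<omega>\<in>space M. block_orthogonal L (W n \<omega>)) \<and>
          as_limit M (\<lambda>n \<omega>. W n \<omega> * Q n \<omega>) Q')"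

end

theory Submission
  imports Defs "Jordan_Normal_Form.Spectral_Radius"
begin

text \<open>Inverting \<open>\<Delta> I\<^sub>p\<^sub>q\<close> shows that \<open>F\<close> has bounded support, so the law of large numbers, here
  from Hoeffding's inequality and Borel-Cantelli, gives \<open>X\<^sup>T X / n \<rightarrow> \<Delta>\<close> almost surely. From
  \<open>X = U |\<Lambda>|\<^sup>1\<^sup>/\<^sup>2 Q\<close> one reads off \<open>Q\<^sup>T |\<Lambda>| Q = X\<^sup>T X\<close> and \<open>Q I\<^sub>p\<^sub>q Q\<^sup>T = sgn \<Lambda>\<close>. In the limit these give
  \<open>K\<^sup>T |L| K = \<Delta>\<close> and \<open>K\<^sup>T |L| L K = \<Delta> I\<^sub>p\<^sub>q \<Delta>\<close> for the limiting matrix \<open>K\<close> and the eigenvalue matrix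
  \<open>L\<close>, which say precisely that \<open>V = \<Delta>\<^sup>-\<^sup>1\<^sup>/\<^sup>2 K\<^sup>T |L|\<^sup>1\<^sup>/\<^sup>2\<close> is orthogonal and diagonalises
  \<open>\<Delta>\<^sup>1\<^sup>/\<^sup>2 I\<^sub>p\<^sub>q \<Delta>\<^sup>1\<^sup>/\<^sup>2\<close>. Since \<open>K\<close> is deterministic, a single sample point suffices for this.\<close>

section \<open>Real symmetric matrices\<close>

text \<open>The eigenvectors \<open>U n\<close> have a growing number of rows, and inside a repeated
  eigenvalue they may turn arbitrarily with \<open>n\<close>. Hence no eigenvector perturbation
  bound is used: \<open>U\<close> cancels by orthonormality of its columns, and two identities
  between \<open>d\<close> by \<open>d\<close> matrices remain. The hypothesis gives convergence of
  \<open>W n * Q n\<close>, not of \<open>Q n\<close>. Orthogonal matrices have bounded entries, so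
  a subsequence of \<open>W n\<close> converges, and \<open>Q n\<close> converges along it. The
  eigenvalues, divided by \<open>n\<close>, then converge as well, being a product of the Gram
  matrix, the alignment and the signs; their order and the characteristic polynomial identify the
  limit. The choice of the subsequence leaves no trace: its limiting rotation commutes with the
  eigenvalue matrix and cancels in both limiting equations. The eigendecomposition is available only
  at full rank, which holds for all large \<open>n\<close>; this is why limits are taken on
  tails.\<close>

lemma square_mult_carrier [simp]:
  "A \<in> carrier_mat n n \<Longrightarrow> B \<in> carrier_mat n n \<Longrightarrow> A * B \<in> carrier_mat n n"
  by (rule mult_carrier_mat)

lemma square_mult_vec_carrier [simp]:
  "A \<in> carrier_mat n n \<Longrightarrow> v \<in> carrier_vec n \<Longrightarrow> A *\<^sub>v v \<in> carrier_vec n"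
  by (rule mult_mat_vec_carrier)

lemma square_one_mult [simp]: "(A :: 'a :: semiring_1 mat) \<in> carrier_mat n n \<Longrightarrow> 1\<^sub>m n * A = A"
  by (rule left_mult_one_mat)

lemma square_mult_one [simp]: "(A :: 'a :: semiring_1 mat) \<in> carrier_mat n n \<Longrightarrow> A * 1\<^sub>m n = A"
  by (rule right_mult_one_mat)

lemma mult_mat_vec_index:
  "A \<in> carrier_mat n m \<Longrightarrow> v \<in> carrier_vec m \<Longrightarrow> i < n \<Longrightarrow> (A *\<^sub>v v) $ i = (\<Sum>j<m. A $$ (i, j) * v $ j)"
  by (auto simp: scalar_prod_def lessThan_atLeast0 intro!: sum.cong)

lemma mult_mat_index:
  "A \<in> carrier_mat n m \<Longrightarrow> B \<in> carrier_mat m k \<Longrightarrow> i < n \<Longrightarrow> j < k \<Longrightarrow>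
    (A * B) $$ (i, j) = (\<Sum>l<m. A $$ (i, l) * B $$ (l, j))"
  by (auto simp: scalar_prod_def lessThan_atLeast0 intro!: sum.cong)

lemma scalar_prod_sum: "w \<in> carrier_vec n \<Longrightarrow> v \<bullet> w = (\<Sum>i<n. v $ i * w $ i)"
  by (auto simp: scalar_prod_def lessThan_atLeast0)

lemma real_mat_inverse:
  fixes A :: "real mat"
  assumes A: "A \<in> carrier_mat n n" and det: "det A \<noteq> 0"
  obtains B where "B \<in> carrier_mat n n" "A * B = 1\<^sub>m n" "B * A = 1\<^sub>m n"
  using det_non_zero_imp_unit[OF A det, of "()"] by (auto simp: Units_def ring_mat_simps)

text \<open>Over the complex numbers an eigenvalue exists, and symmetry makes the form
  \<open>t\<close> equal to its own conjugate, so the eigenvalue is real. It is then a real root of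
  the characteristic polynomial, which yields a real eigenvector; the complex vector
  \<open>w\<close> is not reused.\<close>

lemma real_symmetric_eigenvector:
  fixes A :: "real mat"
  assumes A: "A \<in> carrier_mat n n" and sym: "transpose_mat A = A" and n: "n > 0"
  obtains l v where "v \<in> carrier_vec n" "v \<noteq> 0\<^sub>v n" "A *\<^sub>v v = l \<cdot>\<^sub>v v"
proof -
  define B where "B = map_mat complex_of_real A"
  have B: "B \<in> carrier_mat n n" using A by (simp add: B_def)
  from spectrum_non_empty[OF B n] obtain k where "eigenvalue B k"
    by (auto simp: spectrum_def)
  then obtain w where w: "w \<in> carrier_vec n" "w \<noteq> 0\<^sub>v n" and Bw: "B *\<^sub>v w = k \<cdot>\<^sub>v w"
    using B by (auto simp: eigenvalue_def eigenvector_def)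
  have row: "(\<Sum>j<n. complex_of_real (A $$ (i,j)) * w $ j) = k * w $ i" if "i < n" for i
  proof -
    have "(B *\<^sub>v w) $ i = k * w $ i" using Bw w(1) that by simp
    moreover have "(B *\<^sub>v w) $ i = (\<Sum>j<n. complex_of_real (A $$ (i,j)) * w $ j)"
      using that A w(1) by (auto simp: B_def scalar_prod_def lessThan_atLeast0 intro!: sum.cong)
    ultimately show ?thesis by simp
  qed
  have symA: "A $$ (i,j) = A $$ (j,i)" if "i < n" "j < n" for i j
    using sym A that by (metis carrier_matD index_transpose_mat(1))
  define s where "s = (\<Sum>i<n. (cmod (w $ i))\<^sup>2)"
  define t where "t = (\<Sum>i<n. \<Sum>j<n. complex_of_real (A $$ (i,j)) * w $ j * cnj (w $ i))"
  have t: "t = k * complex_of_real s"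
  proof -
    have "t = (\<Sum>i<n. (\<Sum>j<n. complex_of_real (A $$ (i,j)) * w $ j) * cnj (w $ i))"
      by (simp add: t_def sum_distrib_right)
    also have "\<dots> = (\<Sum>i<n. k * (w $ i * cnj (w $ i)))"
      by (rule sum.cong) (auto simp: row)
    finally show ?thesis
      by (simp add: s_def sum_distrib_left complex_norm_square del: of_real_power)
  qed
  have "cnj t = (\<Sum>j<n. \<Sum>i<n. complex_of_real (A $$ (i,j)) * w $ i * cnj (w $ j))"
    unfolding t_def by (subst sum.swap) (simp add: mult_ac)
  also have "\<dots> = t" unfolding t_def by (intro sum.cong) (auto simp: symA)
  finally have "cnj t = t" .
  obtain i where i: "i < n" "w $ i \<noteq> 0" using w by (metis eq_vecI carrier_vecD index_zero_vec)
  have "s > 0" unfolding s_def using i by (intro sum_pos2[of _ i]) auto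
  with \<open>cnj t = t\<close> t have "cnj k = k" by simp
  then obtain r where r: "k = complex_of_real r" by (metis Reals_cnj_iff Reals_cases)
  have "map_poly complex_of_real (char_poly A) = char_poly B"
    by (simp add: B_def of_real_hom.char_poly_hom[OF A, where ?'a = complex])
  moreover have "poly (char_poly B) k = 0"
    using \<open>eigenvalue B k\<close> eigenvalue_root_char_poly[OF B] by simp
  ultimately have "poly (char_poly A) r = 0"
    unfolding r by (metis of_real_eq_0_iff of_real_hom.poly_map_poly)
  then have "eigenvalue A r" using eigenvalue_root_char_poly[OF A] by simp
  then show ?thesis using that A by (auto simp: eigenvalue_def eigenvector_def)
qed

text \<open>\<open>H\<close> is the Householder reflection that exchanges the first unit vector with
  \<open>v\<close> divided by its length \<open>r\<close>. If the two coincide, the reflection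
  degenerates and the identity serves instead. Being symmetric and involutive, \<open>H\<close> is
  its own inverse and transpose in the spectral theorem.\<close>

lemma exists_orthogonal_first_col:
  fixes v :: "real vec"
  assumes v: "v \<in> carrier_vec (Suc n)" "v \<noteq> 0\<^sub>v (Suc n)"
  obtains H c where "H \<in> carrier_mat (Suc n) (Suc n)" "transpose_mat H = H"
    "H * H = 1\<^sub>m (Suc n)" "H *\<^sub>v unit_vec (Suc n) 0 = c \<cdot>\<^sub>v v" "c \<noteq> 0"
proof -
  let ?n = "Suc n"
  define r where "r = sqrt (\<Sum>i<?n. (v $ i)\<^sup>2)"
  obtain i where i: "i < ?n" "v $ i \<noteq> 0" using v by (metis eq_vecI carrier_vecD index_zero_vec)
  have pos: "(\<Sum>i<?n. (v $ i)\<^sup>2) > 0" using i by (intro sum_pos2[of _ i]) auto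
  then have r: "r > 0" "r * r = (\<Sum>i<?n. (v $ i)\<^sup>2)" by (auto simp: r_def)
  define u where "u i = v $ i / r - (if i = 0 then 1 else 0)" for i
  define s where "s = (\<Sum>i<?n. u i * u i)"
  \<comment> \<open>The vector \<open>u\<close> is the difference of two unit vectors, so its
    squared length is 2 minus twice their inner product.\<close>
  have s: "s = 2 - 2 * (v $ 0 / r)"
  proof -
    have "s = (\<Sum>i<?n. (v $ i)\<^sup>2 / (r * r) - (if i = 0 then 2 * (v $ 0 / r) - 1 else 0))"
      unfolding s_def by (rule sum.cong) (auto simp: u_def algebra_simps power2_eq_square)
    also have "\<dots> = (\<Sum>i<?n. (v $ i)\<^sup>2) / (r * r) - (2 * (v $ 0 / r) - 1)"
      by (simp only: sum_subtractf sum_divide_distrib[symmetric] sum.delta) simp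
    finally show ?thesis using r(1) by (simp add: r(2)[symmetric] del: sum.lessThan_Suc)
  qed
  show ?thesis
  proof (cases "s = 0")
    case True
    have "u i = 0" if "i < ?n" for i
      using True that unfolding s_def by (subst (asm) sum_nonneg_eq_0_iff) auto
    then have "unit_vec ?n 0 = (1 / r) \<cdot>\<^sub>v v"
      using v(1) by (intro eq_vecI) (auto simp: u_def)
    then show ?thesis using r v by (intro that[of "1\<^sub>m ?n" "1 / r"]) auto
  next
    case False
    define c where "c = 2 / s"
    define H where "H = mat ?n ?n (\<lambda>(i,j). (if i = j then 1 else 0) - c * u i * u j)"
    have "H * H = 1\<^sub>m ?n"
    proof (rule eq_matI)
      fix i j assume ij: "i < dim_row (1\<^sub>m ?n :: real mat)" "j < dim_col (1\<^sub>m ?n :: real mat)"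
      have "(H * H) $$ (i,j) = (\<Sum>k<?n. ((if i = k then 1 else 0) - c * u i * u k) * ((if k = j then 1 else 0) - c * u k * u j))"
        using ij by (simp add: H_def scalar_prod_def lessThan_atLeast0 del: sum.op_ivl_Suc)
      also have "\<dots> = (\<Sum>k<?n. (if k = i then (if i = j then 1 else 0) - c * u i * u j else 0)
          - (if k = j then c * u i * u j else 0) + c * c * u i * u j * (u k * u k))"
        by (rule sum.cong) (auto simp: algebra_simps)
      also have "\<dots> = (if i = j then 1 else 0) - c * u i * u j - c * u i * u j + c * c * u i * u j * s"
        using ij unfolding s_def
        by (simp only: sum.distrib sum_subtractf sum_distrib_left[symmetric] sum.delta finite_lessThan) simp
      also have "\<dots> = (1\<^sub>m ?n :: real mat) $$ (i,j)" using ij False by (simp add: c_def)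
      finally show "(H * H) $$ (i,j) = (1\<^sub>m ?n :: real mat) $$ (i,j)" .
    qed (auto simp: H_def)
    moreover have "H *\<^sub>v unit_vec ?n 0 = (1 / r) \<cdot>\<^sub>v v"
    proof (rule eq_vecI)
      fix i assume "i < dim_vec ((1 / r) \<cdot>\<^sub>v v)"
      then have i: "i < ?n" using v by auto
      have "(H *\<^sub>v unit_vec ?n 0) $ i = H $$ (i, 0)"
        using i by (simp add: H_def)
      also have "\<dots> = (if i = 0 then 1 else 0) - c * u 0 * u i" using i by (simp add: H_def)
      \<comment> \<open>By the formula for \<open>s\<close>,
        \<open>u 0 = v $ 0 / r - 1 = - s / 2\<close>.\<close>
      also have "c * u 0 = -1" using False s by (auto simp: c_def u_def field_simps)
      finally show "(H *\<^sub>v unit_vec ?n 0) $ i = ((1 / r) \<cdot>\<^sub>v v) $ i"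
        using i v by (auto simp: u_def)
    qed (use v in \<open>auto simp: H_def\<close>)
    ultimately show ?thesis using r
      by (intro that[of H "1 / r"]) (auto simp: H_def)
  qed
qed

lemma orthonormal_colsD:
  assumes "orthonormal_cols d d V"
  shows "V \<in> carrier_mat d d" "transpose_mat V * V = 1\<^sub>m d" "V * transpose_mat V = 1\<^sub>m d"
  using assms mat_mult_left_right_inverse[of "transpose_mat V" d V]
  by (auto simp: orthonormal_cols_def)

text \<open>Deflation: conjugating by the reflection makes the first unit vector an eigenvector of
  \<open>B\<close>, and symmetry then clears the rest of the first row as well as of the first
  column. The induction hypothesis applies to the remaining block \<open>C\<close>.\<close>

theorem real_spectral_theorem:
  fixes A :: "real mat"
  assumes "A \<in> carrier_mat n n" "transpose_mat A = A"
  shows "\<exists>V f. orthonormal_cols n n V \<and> A = V * mat_diag n f * transpose_mat V"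
  using assms
proof (induction n arbitrary: A)
  case 0
  show ?case
    by (intro exI[of _ "1\<^sub>m 0"] exI[of _ "\<lambda>_. 0"] conjI)
      (use 0 in \<open>auto simp: orthonormal_cols_def mat_diag_def\<close>)
next
  case (Suc n)
  let ?n = "Suc n" and ?e = "unit_vec (Suc n) 0 :: real vec"
  note A = Suc.prems
  obtain l v where v: "v \<in> carrier_vec ?n" "v \<noteq> 0\<^sub>v ?n" "A *\<^sub>v v = l \<cdot>\<^sub>v v"
    using real_symmetric_eigenvector[OF A] by blast
  obtain H c where H: "H \<in> carrier_mat ?n ?n" "transpose_mat H = H" "H * H = 1\<^sub>m ?n"
    and c: "H *\<^sub>v ?e = c \<cdot>\<^sub>v v" "c \<noteq> 0"
    using exists_orthogonal_first_col[OF v(1,2)] by blast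
  define B where "B = H * A * H"
  have B: "B \<in> carrier_mat ?n ?n" using H A by (simp add: B_def)
  have BT: "transpose_mat B = B"
    using H A by (simp add: B_def transpose_mult[of _ ?n ?n _ ?n] assoc_mult_mat[of _ ?n ?n _ ?n _ ?n])
  have "B *\<^sub>v ?e = H *\<^sub>v (A *\<^sub>v (H *\<^sub>v ?e))"
    using H A by (simp add: B_def assoc_mult_mat_vec[of _ ?n ?n _ ?n])
  also have "\<dots> = H *\<^sub>v (c \<cdot>\<^sub>v (l \<cdot>\<^sub>v v))"
    using c A v by (simp add: mult_mat_vec[of A ?n ?n])
  also have "c \<cdot>\<^sub>v (l \<cdot>\<^sub>v v) = l \<cdot>\<^sub>v (H *\<^sub>v ?e)"
    using c by (simp add: smult_smult_assoc mult.commute)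
  also have "H *\<^sub>v (l \<cdot>\<^sub>v (H *\<^sub>v ?e)) = l \<cdot>\<^sub>v (H *\<^sub>v (H *\<^sub>v ?e))"
    using H by (intro mult_mat_vec) auto
  also have "H *\<^sub>v (H *\<^sub>v ?e) = ?e"
    using H by (simp flip: assoc_mult_mat_vec[of H ?n ?n H ?n])
  finally have Be: "B *\<^sub>v ?e = l \<cdot>\<^sub>v ?e" .
  have col0: "B $$ (i, 0) = (if i = 0 then l else 0)" if "i < ?n" for i
  proof -
    have "B $$ (i, 0) = (B *\<^sub>v ?e) $ i" using that B by simp
    then show ?thesis using that by (simp add: Be)
  qed
  have B_entry: "B $$ (i, j) = B $$ (j, i)" if "i < ?n" "j < ?n" for i j
    using arg_cong[OF BT, of "\<lambda>M. M $$ (i, j)"] B that by simp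
  have row0: "B $$ (0, i) = (if i = 0 then l else 0)" if "i < ?n" for i
    using col0[OF that] B_entry[of 0 i] that by simp
  define C where "C = mat n n (\<lambda>(i,j). B $$ (Suc i, Suc j))"
  have C: "C \<in> carrier_mat n n" by (simp add: C_def)
  have "transpose_mat C = C"
    by (intro eq_matI) (auto simp: C_def B_entry)
  from Suc.IH[OF C this] obtain W f where W: "orthonormal_cols n n W"
    and CW: "C = W * mat_diag n f * transpose_mat W" by blast
  note Wd = orthonormal_colsD[OF W]
  define K where "K = four_block_mat (1\<^sub>m 1) (0\<^sub>m 1 n) (0\<^sub>m n 1) W"
  have K: "K \<in> carrier_mat ?n ?n" using Wd by (simp add: K_def four_block_carrier_mat[of _ 1 1 _ n n, simplified])
  have KT: "transpose_mat K = four_block_mat (1\<^sub>m 1) (0\<^sub>m 1 n) (0\<^sub>m n 1) (transpose_mat W)"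
    using Wd by (simp add: K_def transpose_four_block_mat[of _ 1 1 _ n _ n])
  have KK: "transpose_mat K * K = 1\<^sub>m ?n"
    unfolding KT unfolding K_def using Wd
    by (subst mult_four_block_mat[of _ 1 1 _ n _ n _ _ 1 _ n]) auto
  define g where "g = (\<lambda>i. case i of 0 \<Rightarrow> l | Suc i \<Rightarrow> f i)"
  have g: "mat_diag ?n g = four_block_mat (mat 1 1 (\<lambda>_. l)) (0\<^sub>m 1 n) (0\<^sub>m n 1) (mat_diag n f)"
    by (rule eq_matI) (auto simp: g_def mat_diag_def split: nat.splits)
  have "B = four_block_mat (mat 1 1 (\<lambda>_. l)) (0\<^sub>m 1 n) (0\<^sub>m n 1) C"
    using B by (intro eq_matI) (auto simp: C_def col0 row0)
  also have "\<dots> = K * mat_diag ?n g * transpose_mat K"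
  proof -
    have "K * mat_diag ?n g = four_block_mat (mat 1 1 (\<lambda>_. l)) (0\<^sub>m 1 n) (0\<^sub>m n 1) (W * mat_diag n f)"
      unfolding K_def g using Wd(1)
      by (subst mult_four_block_mat[of _ 1 1 _ n _ n _ _ 1 _ n]) (simp_all add: left_mult_zero_mat[of _ n n])
    then show ?thesis
      unfolding KT using Wd(1)
      by (simp add: mult_four_block_mat[of _ 1 1 _ n _ n _ _ 1 _ n] CW right_mult_zero_mat[of _ n n] left_add_zero_mat[of _ n n])
  qed
  finally have BK: "B = K * mat_diag ?n g * transpose_mat K" .
  have "A = H * B * H"
  proof -
    have "H * B * H = (H * H) * A * (H * H)"
      using H(1) A(1) unfolding B_def by (simp add: assoc_mult_mat[of _ ?n ?n _ ?n _ ?n])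
    then show ?thesis using H A by simp
  qed
  also have "\<dots> = (H * K) * mat_diag ?n g * transpose_mat (H * K)"
    using H K by (simp add: BK transpose_mult[of H ?n ?n K ?n] assoc_mult_mat[of _ ?n ?n _ ?n _ ?n])
  finally have AK: "A = (H * K) * mat_diag ?n g * transpose_mat (H * K)" .
  have "transpose_mat (H * K) * (H * K) = transpose_mat K * ((H * H) * K)"
    using H(1,2) K by (simp add: transpose_mult[of H ?n ?n K ?n] assoc_mult_mat[of _ ?n ?n _ ?n _ ?n])
  also have "\<dots> = 1\<^sub>m ?n" using H K KK by simp
  finally have "orthonormal_cols ?n ?n (H * K)" using H K by (simp add: orthonormal_cols_def)
  with AK show ?case by blast
qed

lemma quadratic_form_mat_diag:
  fixes V :: "real mat"
  assumes V: "V \<in> carrier_mat n n" and v: "v \<in> carrier_vec n"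
  shows "v \<bullet> ((V * mat_diag n f * transpose_mat V) *\<^sub>v v) =
    (\<Sum>i<n. f i * ((transpose_mat V *\<^sub>v v) $ i)\<^sup>2)"
proof -
  let ?w = "transpose_mat V *\<^sub>v v"
  have w: "?w \<in> carrier_vec n" using V v by simp
  have "v \<bullet> ((V * mat_diag n f * transpose_mat V) *\<^sub>v v) = v \<bullet> (V *\<^sub>v (mat_diag n f *\<^sub>v ?w))"
    using V v by (simp add: assoc_mult_mat_vec[of _ n n _ n])
  also have "\<dots> = ?w \<bullet> (mat_diag n f *\<^sub>v ?w)"
    using V v w by (intro transpose_vec_mult_scalar[symmetric]) auto
  also have "mat_diag n f *\<^sub>v ?w = vec n (\<lambda>i. f i * ?w $ i)"
  proof (rule eq_vecI)
    fix i assume "i < dim_vec (vec n (\<lambda>i. f i * ?w $ i))"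
    then have i: "i < n" by simp
    have "(mat_diag n f *\<^sub>v ?w) $ i = (\<Sum>j<n. (if i = j then f j else 0) * ?w $ j)"
      using i V by (simp add: mat_diag_def scalar_prod_def lessThan_atLeast0 del: index_mult_mat_vec)
        (simp add: scalar_prod_def)
    also have "\<dots> = (\<Sum>j<n. if j = i then f j * ?w $ j else 0)"
      by (rule sum.cong) auto
    finally show "(mat_diag n f *\<^sub>v ?w) $ i = vec n (\<lambda>i. f i * ?w $ i) $ i" using i by simp
  qed (simp add: mat_diag_def)
  finally show ?thesis using V
    by (simp add: scalar_prod_def lessThan_atLeast0 power2_eq_square mult_ac del: index_mult_mat_vec)
qed

section \<open>Positive semidefinite square roots\<close>

lemma psd_sqrt_ex:
  assumes "psd_mat A"
  shows "\<exists>S. psd_mat S \<and> S * S = A"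
proof -
  define n where "n = dim_row A"
  have A: "A \<in> carrier_mat n n" "transpose_mat A = A"
    and psd: "\<And>v. v \<in> carrier_vec n \<Longrightarrow> 0 \<le> v \<bullet> (A *\<^sub>v v)"
    using assms by (auto simp: psd_mat_def n_def)
  obtain V f where V: "orthonormal_cols n n V" and AV: "A = V * mat_diag n f * transpose_mat V"
    using real_spectral_theorem[OF A] by blast
  note Vd = orthonormal_colsD[OF V]
  \<comment> \<open>\<open>f i\<close> is the value of the quadratic form of \<open>A\<close> at the
    \<open>i\<close>-th column of \<open>V\<close>.\<close>
  have f: "f i \<ge> 0" if i: "i < n" for i
  proof -
    have "transpose_mat V *\<^sub>v (V *\<^sub>v unit_vec n i) = unit_vec n i"
      using Vd by (simp flip: assoc_mult_mat_vec[of _ n n _ n])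
    then have "(V *\<^sub>v unit_vec n i) \<bullet> (A *\<^sub>v (V *\<^sub>v unit_vec n i)) = (\<Sum>j<n. f j * (unit_vec n i $ j)\<^sup>2)"
      unfolding AV using Vd by (subst quadratic_form_mat_diag) auto
    also have "\<dots> = (\<Sum>j<n. if j = i then f j else 0)" by (rule sum.cong) (auto simp: i)
    also have "\<dots> = f i" using i by simp
    finally show ?thesis using psd[of "V *\<^sub>v unit_vec n i"] Vd by simp
  qed
  define g where "g = mat_diag n (\<lambda>i. sqrt (f i))"
  have g: "g \<in> carrier_mat n n" "transpose_mat g = g" "g * g = mat_diag n f"
    using f by (simp_all add: g_def) (auto simp: mat_diag_def)
  define S where "S = V * g * transpose_mat V"
  have S: "S \<in> carrier_mat n n"
    unfolding S_def using Vd g by simp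
  have "S * S = V * (g * ((transpose_mat V * V) * (g * transpose_mat V)))"
    unfolding S_def using Vd(1) g(1) by (simp add: assoc_mult_mat[of _ n n _ n _ n])
  also have "\<dots> = V * (g * g) * transpose_mat V"
    using Vd g(1) by (simp add: assoc_mult_mat[of _ n n _ n _ n])
  finally have SS: "S * S = A" by (simp add: g AV)
  have "transpose_mat S = S"
    unfolding S_def using Vd g
    by (simp add: transpose_mult[of _ n n _ n] assoc_mult_mat[of _ n n _ n _ n])
  moreover have "0 \<le> v \<bullet> (S *\<^sub>v v)" if "v \<in> carrier_vec n" for v
    unfolding S_def g_def using Vd that f by (subst quadratic_form_mat_diag) (auto intro!: sum_nonneg)
  ultimately have "psd_mat S" using S by (auto simp: psd_mat_def)
  with SS show ?thesis by blast
qed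

text \<open>The entry is the quadratic form of \<open>S\<close> at the \<open>i\<close>-th column of
  \<open>V\<close>.\<close>

lemma psd_congruence_diag_nonneg:
  assumes "psd_mat S" "S \<in> carrier_mat n n" "V \<in> carrier_mat n n" "i < n"
  shows "0 \<le> (transpose_mat V * S * V) $$ (i, i)"
proof -
  have "(transpose_mat V * S * V) $$ (i, i) = (transpose_mat V * (S * V)) $$ (i, i)"
    using assms by (simp add: assoc_mult_mat[of _ n n _ n _ n])
  also have "\<dots> = row (transpose_mat V) i \<bullet> col (S * V) i"
    using assms by (intro index_mult_mat(1)) auto
  also have "\<dots> = col V i \<bullet> (S *\<^sub>v col V i)"
    using assms by (simp only: row_transpose col_mult2[of S n n V n] carrier_matD)
  finally have "(transpose_mat V * S * V) $$ (i, i) = col V i \<bullet> (S *\<^sub>v col V i)" .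
  then show ?thesis using assms by (auto simp: psd_mat_def)
qed

text \<open>In an orthonormal eigenbasis of \<open>S - T\<close>, the relation \<open>S (S - T) + (S - T) T = 0\<close> reads
  \<open>f\<^sub>i (S\<^sub>i\<^sub>i + T\<^sub>i\<^sub>i) = 0\<close> on the diagonal, while \<open>f\<^sub>i = S\<^sub>i\<^sub>i - T\<^sub>i\<^sub>i\<close>.\<close>

lemma psd_sqrt_unique:
  assumes S: "psd_mat S" and T: "psd_mat T" and eq: "S * S = T * T"
  shows "S = T"
proof -
  define n where "n = dim_row S"
  have Sc: "S \<in> carrier_mat n n" "transpose_mat S = S" using S by (auto simp: psd_mat_def n_def)
  have "dim_row T = n" using arg_cong[OF eq, of dim_row] by (simp add: n_def)
  then have Tc: "T \<in> carrier_mat n n" "transpose_mat T = T" using T by (auto simp: psd_mat_def)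
  have "transpose_mat (S - T) = S - T" using Sc Tc by (simp add: transpose_minus[of _ n n])
  then obtain V f where V: "orthonormal_cols n n V" and CV: "S - T = V * mat_diag n f * transpose_mat V"
    using real_spectral_theorem[of "S - T" n] minus_carrier_mat[OF Tc(1), of S] by blast
  note Vd = orthonormal_colsD[OF V]
  define s where "s = transpose_mat V * S * V"
  define t where "t = transpose_mat V * T * V"
  have st: "s \<in> carrier_mat n n" "t \<in> carrier_mat n n" using Vd Sc Tc by (auto simp: s_def t_def)
  have conj: "transpose_mat V * M * V * (transpose_mat V * N * V) = transpose_mat V * (M * N) * V"
    if "M \<in> carrier_mat n n" "N \<in> carrier_mat n n" for M N
  proof -
    have "transpose_mat V * M * V * (transpose_mat V * N * V) =
        transpose_mat V * (M * ((V * transpose_mat V) * (N * V)))"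
      using that Vd(1) by (simp add: assoc_mult_mat[of _ n n _ n _ n])
    then show ?thesis using that Vd by (simp add: assoc_mult_mat[of _ n n _ n _ n])
  qed
  have ss: "s * s = t * t" unfolding s_def t_def using conj Sc Tc eq by simp
  have "s - t = transpose_mat V * (S - T) * V"
    unfolding s_def t_def using Vd Sc Tc
    by (simp add: mult_minus_distrib_mat[of _ n n] minus_mult_distrib_mat[of _ n n])
  also have "\<dots> = (transpose_mat V * V) * mat_diag n f * (transpose_mat V * V)"
    unfolding CV using Vd(1) by (simp add: assoc_mult_mat[of _ n n _ n _ n])
  also have "\<dots> = mat_diag n f" using Vd by (simp add: left_mult_one_mat[OF mat_diag_dim] right_mult_one_mat[OF mat_diag_dim])
  finally have diff: "s - t = mat_diag n f" .
  have "s * mat_diag n f + mat_diag n f * t = 0\<^sub>m n n"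
  proof -
    have "s * (s - t) + (s - t) * t = s * s - s * t + (s * t - t * t)"
      using st by (simp add: mult_minus_distrib_mat[of _ n n] minus_mult_distrib_mat[of _ n n])
    also have "\<dots> = 0\<^sub>m n n" unfolding ss using st by (intro eq_matI) auto
    finally show ?thesis unfolding diff .
  qed
  moreover have "(s * mat_diag n f + mat_diag n f * t) $$ (i, i) = f i * (s $$ (i,i) + t $$ (i,i))" if "i < n" for i
    using st that by (simp add: mat_diag_mult_left[of _ n n] mat_diag_mult_right[of _ n n] algebra_simps)
  ultimately have prod0: "f i * (s $$ (i,i) + t $$ (i,i)) = 0" if "i < n" for i
    using that by (metis index_zero_mat(1))
  \<comment> \<open>Either \<open>f i\<close> is 0 or the two nonnegative diagonal entries add up to
    0. In the second case both vanish, and so does their difference \<open>f i\<close>.\<close>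
  have "f i = 0" if i: "i < n" for i
  proof -
    have "f i = s $$ (i,i) - t $$ (i,i)"
      using arg_cong[OF diff, of "\<lambda>M. M $$ (i,i)"] i st by (simp add: mat_diag_def)
    moreover have "s $$ (i,i) \<ge> 0" "t $$ (i,i) \<ge> 0"
      using psd_congruence_diag_nonneg S T Sc Tc Vd i by (auto simp: s_def t_def)
    ultimately show ?thesis using prod0[OF i] by auto
  qed
  then have "mat_diag n f = 0\<^sub>m n n" by (auto simp: mat_diag_def)
  then have "S - T = 0\<^sub>m n n" unfolding CV using Vd by simp
  moreover have "S = (S - T) + T" using Sc Tc by (intro eq_matI) auto
  ultimately show ?thesis using Tc(1) by (metis left_add_zero_mat)
qed

lemma psd_sqrt:
  assumes "psd_mat A"
  shows "psd_mat (psd_sqrt A)" "psd_sqrt A * psd_sqrt A = A"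
proof -
  have "\<exists>!S. psd_mat S \<and> S * S = A"
    using psd_sqrt_ex[OF assms] psd_sqrt_unique by metis
  from theI'[OF this] show "psd_mat (psd_sqrt A)" "psd_sqrt A * psd_sqrt A = A"
    by (auto simp: psd_sqrt_def)
qed

section \<open>Bounded samples and the law of large numbers\<close>

lemma vec_index_measurable [measurable]:
  assumes "i < d"
  shows "(\<lambda>x. x $ i) \<in> borel_measurable (vec_borel d)"
proof -
  have "(\<lambda>v. \<lambda>i\<in>{..<d}. v $ i) \<in> measurable (vec_borel d) (PiM {..<d} (\<lambda>_. borel :: real measure))"
    unfolding vec_borel_def by (rule measurable_vimage_algebra1) (auto simp: space_PiM)
  from measurable_compose[OF this measurable_component_singleton[of i]]
  show ?thesis using assms by simp
qed

lemma space_vec_borel [simp]: "space (vec_borel d) = carrier_vec d"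
  by (simp add: vec_borel_def)

lemma (in prob_space) strong_law_bounded_iid:
  fixes Y :: "nat \<Rightarrow> 'a \<Rightarrow> real"
  assumes indep: "indep_vars (\<lambda>_. borel) Y UNIV"
    and ident: "\<And>i. distr M borel (Y i) = distr M borel (Y 0)"
    and bound: "AE x in M. \<bar>Y 0 x\<bar> \<le> B"
  shows "AE x in M. (\<lambda>n. (\<Sum>i<n. Y i x) / n) \<longlonglongrightarrow> expectation (Y 0)"
proof -
  have rv [measurable]: "Y i \<in> borel_measurable M" for i
    using indep by (simp add: indep_vars_def)
  \<comment> \<open>Hoeffding's inequality wants a nondegenerate interval \<open>{- b..b}\<close>,
    also when \<open>B\<close> is 0.\<close>
  define b where "b = max B 1"
  have b: "- b < b" by (auto simp: b_def)
  define \<mu> where "\<mu> = expectation (Y 0)"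
  have deviation: "AE x in M. eventually (\<lambda>n. \<bar>(\<Sum>i<n. Y i x) / n - \<mu>\<bar> < \<epsilon>) sequentially"
    if "\<epsilon> > 0" for \<epsilon> :: real
  proof -
    define A where "A n = {x \<in> space M. \<bar>(\<Sum>i<n. Y i x) / n - \<mu>\<bar> \<ge> \<epsilon>}" for n :: nat
    \<comment> \<open>Hoeffding's bound for \<open>n\<close> samples is \<open>2 * r ^ n\<close>, so
      the deviation probabilities are dominated by a geometric series.\<close>
    define r where "r = exp (-2 * \<epsilon>\<^sup>2 / (b - (-b))\<^sup>2)"
    have r: "0 < r" "r < 1" using that by (auto simp: r_def b_def)
    have prob_A: "prob (A n) \<le> 2 * r ^ n" if "n \<ge> 1" for n
    proof -
      have ne: "{..<n} \<noteq> {}" using that by (auto simp: lessThan_empty_iff)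
      have "AE x in M. Y 0 x \<in> {- b..b}"
        using bound by (rule eventually_mono) (auto simp: b_def)
      then have "Hoeffding_ineq_iid M {..<n} Y (Y 0) (- b) b"
        unfolding Hoeffding_ineq_iid_def iid_interval_bounded_random_variables_def
          iid_interval_bounded_random_variables_axioms_def
        using indep_vars_subset[OF indep, of "{..<n}"] ident rv prob_space_axioms
        by (meson finite_lessThan subset_UNIV)
      from Hoeffding_ineq_iid.Hoeffding_ineq_abs_ge'[OF this less_imp_le[OF \<open>\<epsilon> > 0\<close>] b ne]
      have "prob (A n) \<le> 2 * exp (-2 * real n * \<epsilon>\<^sup>2 / (b - (-b))\<^sup>2)"
        unfolding A_def \<mu>_def card_lessThan .
      also have "exp (-2 * real n * \<epsilon>\<^sup>2 / (b - (-b))\<^sup>2) = r ^ n"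
        by (simp add: r_def flip: exp_of_nat_mult)
      finally show ?thesis .
    qed
    have "AE x in M. eventually (\<lambda>n. x \<in> space M - A n) sequentially"
    proof (rule borel_cantelli_AE1)
      show "A n \<in> sets M" for n unfolding A_def by measurable
      show "emeasure M (A n) < \<infinity>" for n by (simp add: emeasure_eq_measure)
      show "summable (\<lambda>n. prob (A n))"
      proof (rule summable_comparison_test')
        show "summable (\<lambda>n. 2 * r ^ n)" using r by (intro summable_mult summable_geometric) simp
        show "norm (prob (A n)) \<le> 2 * r ^ n" if "n \<ge> 1" for n using prob_A[OF that] by simp
      qed
    qed
    then show ?thesis by (auto simp: A_def not_le elim!: eventually_mono)
  qed
  \<comment> \<open>Countably many thresholds suffice for convergence, and countably many
    exceptional null sets can be united.\<close>
  have "AE x in M. \<forall>k. eventually (\<lambda>n. \<bar>(\<Sum>i<n. Y i x) / n - \<mu>\<bar> < 1 / Suc k) sequentially"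
    by (subst AE_all_countable) (auto intro: deviation)
  then show ?thesis
  proof (rule eventually_mono)
    fix x assume x: "\<forall>k. eventually (\<lambda>n. \<bar>(\<Sum>i<n. Y i x) / n - \<mu>\<bar> < 1 / Suc k) sequentially"
    show "(\<lambda>n. (\<Sum>i<n. Y i x) / n) \<longlonglongrightarrow> expectation (Y 0)"
    proof (rule tendstoI)
      fix e :: real assume "e > 0"
      then obtain k where k: "1 / Suc k < e" using nat_approx_posE by metis
      show "eventually (\<lambda>n. dist ((\<Sum>i<n. Y i x) / n) (expectation (Y 0)) < e) sequentially"
        by (rule eventually_mono[OF spec[OF x, of k]]) (use k in \<open>auto simp: dist_real_def \<mu>_def\<close>)
    qed
  qed
qed

lemma strong_law_second_moments:
  fixes X :: "nat \<Rightarrow> 'a \<Rightarrow> real vec"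
  assumes "prob_space M" and indep: "prob_space.indep_vars M (\<lambda>_. vec_borel d) X UNIV"
    and distr: "\<And>i. distr M (vec_borel d) (X i) = F"
    and bound: "AE x in F. \<forall>i<d. \<bar>x $ i\<bar> \<le> B"
  shows "AE \<omega> in M. \<forall>i<d. \<forall>j<d.
    (\<lambda>n. (\<Sum>k<n. X k \<omega> $ i * X k \<omega> $ j) / n) \<longlonglongrightarrow> second_moment_mat d F $$ (i, j)"
proof -
  interpret prob_space M by fact
  have rv [measurable]: "X i \<in> measurable M (vec_borel d)" for i
    using indep by (simp add: indep_vars_def)
  have "AE \<omega> in M. (\<lambda>n. (\<Sum>k<n. X k \<omega> $ i * X k \<omega> $ j) / n) \<longlonglongrightarrow> second_moment_mat d F $$ (i, j)"
    if ij: "i < d" "j < d" for i j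
  proof -
    define f :: "real vec \<Rightarrow> real" where "f x = x $ i * x $ j" for x
    have f [measurable]: "f \<in> borel_measurable (vec_borel d)"
      unfolding f_def using ij by measurable
    have "indep_vars (\<lambda>_. borel) (\<lambda>k \<omega>. f (X k \<omega>)) UNIV"
      by (rule indep_vars_compose2[OF indep]) simp
    moreover have "distr M borel (\<lambda>\<omega>. f (X k \<omega>)) = distr F borel f" for k
      unfolding distr[of k, symmetric] by (subst distr_distr) (auto simp: o_def)
    moreover have "AE \<omega> in M. \<bar>f (X 0 \<omega>)\<bar> \<le> B * B"
    proof -
      have "AE \<omega> in M. \<forall>i<d. \<bar>X 0 \<omega> $ i\<bar> \<le> B"
        using bound unfolding distr[of 0, symmetric] by (rule AE_distrD[rotated]) simp
      then show ?thesis
      proof (rule eventually_mono)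
        fix \<omega> assume "\<forall>i<d. \<bar>X 0 \<omega> $ i\<bar> \<le> B"
        then have "\<bar>X 0 \<omega> $ i\<bar> \<le> B" "\<bar>X 0 \<omega> $ j\<bar> \<le> B" using ij by auto
        then show "\<bar>f (X 0 \<omega>)\<bar> \<le> B * B"
          unfolding f_def abs_mult by (intro mult_mono) auto
      qed
    qed
    ultimately have "AE \<omega> in M. (\<lambda>n. (\<Sum>k<n. f (X k \<omega>)) / n) \<longlonglongrightarrow> expectation (\<lambda>\<omega>. f (X 0 \<omega>))"
      by (intro strong_law_bounded_iid) auto
    moreover have "expectation (\<lambda>\<omega>. f (X 0 \<omega>)) = (\<integral>x. f x \<partial>F)"
      unfolding distr[of 0, symmetric] by (subst integral_distr) auto
    ultimately show ?thesis using ij by (simp add: f_def second_moment_mat_def)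
  qed
  then have "AE \<omega> in M. \<forall>i\<in>{..<d}. \<forall>j\<in>{..<d}.
    (\<lambda>n. (\<Sum>k<n. X k \<omega> $ i * X k \<omega> $ j) / n) \<longlonglongrightarrow> second_moment_mat d F $$ (i, j)"
    by (intro AE_finite_allI) auto
  then show ?thesis by (simp add: Ball_def)
qed

section \<open>The second moment matrix and the boundedness of the support\<close>

lemma second_moment_mat_carrier [simp]: "second_moment_mat d F \<in> carrier_mat d d"
  by (simp add: second_moment_mat_def)

text \<open>The quadratic form at \<open>v\<close> is the mean of the squared inner product of
  \<open>v\<close> with \<open>x\<close>.\<close>

lemma psd_second_moment_mat:
  assumes "has_second_moments d F"
  shows "psd_mat (second_moment_mat d F)"
proof -
  have int: "integrable F (\<lambda>x. x $ i * x $ j)" if "i < d" "j < d" for i j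
    using assms that by (auto simp: has_second_moments_def)
  have "0 \<le> v \<bullet> (second_moment_mat d F *\<^sub>v v)" if v: "v \<in> carrier_vec d" for v
  proof -
    have "v \<bullet> (second_moment_mat d F *\<^sub>v v) = (\<Sum>i<d. \<Sum>j<d. (\<integral>x. v $ i * v $ j * (x $ i * x $ j) \<partial>F))"
      using v by (simp add: scalar_prod_sum[of _ d] mult_mat_vec_index[of _ d d] sum_distrib_left mult.assoc
          del: index_mult_mat_vec) (simp add: second_moment_mat_def mult_ac)
    also have "\<dots> = (\<integral>x. (\<Sum>i<d. \<Sum>j<d. v $ i * v $ j * (x $ i * x $ j)) \<partial>F)"
      by (subst Bochner_Integration.integral_sum, force intro: int)+ (simp add: int)
    also have "\<dots> = (\<integral>x. (\<Sum>i<d. v $ i * x $ i)\<^sup>2 \<partial>F)"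
      by (simp add: power2_eq_square sum_product mult_ac)
    finally show ?thesis by simp
  qed
  then show ?thesis by (auto simp: psd_mat_def second_moment_mat_def mult.commute)
qed

lemma sig_mat_carrier [simp]: "sig_mat p q \<in> carrier_mat (p + q) (p + q)"
  by (intro carrier_matI) (simp_all add: sig_mat_def dim_diag_block_mat)

text \<open>For \<open>x \<in> \<Omega>\<close>, the \<open>i\<close>-th entry of \<open>\<Delta> I\<^sub>p\<^sub>q x\<close> is the mean of \<open>y\<^sub>i \<cdot> (y\<^sup>T I\<^sub>p\<^sub>q x)\<close>, whose
  second factor lies in \<open>[0, 1]\<close>; inverting \<open>\<Delta> I\<^sub>p\<^sub>q\<close> bounds \<open>x\<close> itself.\<close>

lemma gen_inner_product_distribution_bounded:
  assumes F: "gen_inner_product_distribution p q F" and d: "d = p + q"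
    and mom: "has_second_moments d F"
    and det: "det (second_moment_mat d F * sig_mat p q) \<noteq> 0"
  obtains B where "AE x in F. \<forall>i<d. \<bar>x $ i\<bar> \<le> B"
proof -
  let ?\<Delta> = "second_moment_mat d F" and ?I = "sig_mat p q"
  from F obtain \<Omega> where \<Omega>: "\<Omega> \<subseteq> carrier_vec d" "AE x in F. x \<in> \<Omega>"
    and ip: "\<And>x y. x \<in> \<Omega> \<Longrightarrow> y \<in> \<Omega> \<Longrightarrow> x \<bullet> (?I *\<^sub>v y) \<in> {0..1}"
    and "prob_space F" and sets [measurable_cong]: "sets F = sets (vec_borel d)"
    by (auto simp: gen_inner_product_distribution_def d)
  interpret prob_space F by fact
  have int: "integrable F (\<lambda>x. x $ i * x $ j)" if "i < d" "j < d" for i j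
    using mom that by (auto simp: has_second_moments_def)
  have I: "?I \<in> carrier_mat d d" by (simp add: d)
  obtain H where H: "H \<in> carrier_mat d d" "H * (?\<Delta> * ?I) = 1\<^sub>m d"
    using real_mat_inverse[of "?\<Delta> * ?I" d] det I by (metis second_moment_mat_carrier square_mult_carrier)
  have row_bound: "\<bar>(?\<Delta> *\<^sub>v (?I *\<^sub>v x)) $ i\<bar> \<le> 1 + ?\<Delta> $$ (i, i)" if x: "x \<in> \<Omega>" and i: "i < d" for x i
  proof -
    let ?z = "?I *\<^sub>v x"
    have z: "?z \<in> carrier_vec d" using I x \<Omega>(1) by auto
    have intsum: "integrable F (\<lambda>y. \<Sum>j<d. ?z $ j * (y $ i * y $ j))"
      by (intro Bochner_Integration.integrable_sum integrable_mult_right int) (use i in auto)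
    have "(?\<Delta> *\<^sub>v ?z) $ i = (\<Sum>j<d. (\<integral>y. ?z $ j * (y $ i * y $ j) \<partial>F))"
      using i by (subst mult_mat_vec_index[OF second_moment_mat_carrier z i])
        (simp add: second_moment_mat_def mult.commute del: index_mult_mat_vec)
    also have "\<dots> = (\<integral>y. (\<Sum>j<d. ?z $ j * (y $ i * y $ j)) \<partial>F)"
      by (rule Bochner_Integration.integral_sum[symmetric]) (intro integrable_mult_right int, use i in auto)
    finally have "\<bar>(?\<Delta> *\<^sub>v ?z) $ i\<bar> \<le> (\<integral>y. \<bar>\<Sum>j<d. ?z $ j * (y $ i * y $ j)\<bar> \<partial>F)"
      by simp
    \<comment> \<open>The integrand is at most \<open>\<bar>y $ i\<bar>\<close>, but the moment
      hypothesis speaks of products of two coordinates. The first power is therefore dominated by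
      \<open>1 + y $ i * y $ i\<close>.\<close>
    also have "\<dots> \<le> (\<integral>y. 1 + y $ i * y $ i \<partial>F)"
    proof (rule integral_mono_AE)
      show "AE y in F. \<bar>\<Sum>j<d. ?z $ j * (y $ i * y $ j)\<bar> \<le> 1 + y $ i * y $ i"
        using \<Omega>(2)
      proof (rule eventually_mono)
        fix y assume y: "y \<in> \<Omega>"
        have "(\<Sum>j<d. ?z $ j * (y $ i * y $ j)) = y $ i * (y \<bullet> ?z)"
          by (simp add: scalar_prod_sum[OF z] sum_distrib_left mult_ac del: index_mult_mat_vec)
        also have "\<bar>\<dots>\<bar> \<le> \<bar>y $ i\<bar> * 1"
          unfolding abs_mult using ip[OF y x] by (intro mult_left_mono) auto
        \<comment> \<open>Expanding the square of \<open>\<bar>y $ i\<bar> - 1/2\<close> gives the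
          bound even with 1/4 in place of 1.\<close>
        also have "\<bar>y $ i\<bar> * 1 \<le> 1 + y $ i * y $ i"
          using sum_squares_ge_zero[of "\<bar>y $ i\<bar> - 1/2" 0] by (simp add: algebra_simps)
        finally show "\<bar>\<Sum>j<d. ?z $ j * (y $ i * y $ j)\<bar> \<le> 1 + y $ i * y $ i" .
      qed
    qed (use intsum int[OF i i] in auto)
    also have "\<dots> = 1 + ?\<Delta> $$ (i, i)"
      using int[OF i i] i by (simp add: second_moment_mat_def prob_space)
    finally show ?thesis .
  qed
  \<comment> \<open>The inner sum bounds the coordinate \<open>j\<close>; adding up over
    \<open>j\<close> gives one constant for all coordinates, independent of
    \<open>x\<close>.\<close>
  define B where "B = (\<Sum>j<d. \<Sum>i<d. \<bar>H $$ (j, i)\<bar> * (1 + ?\<Delta> $$ (i, i)))"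
  have "\<bar>x $ j\<bar> \<le> B" if x: "x \<in> \<Omega>" and j: "j < d" for x j
  proof -
    let ?w = "?\<Delta> *\<^sub>v (?I *\<^sub>v x)"
    have xc: "x \<in> carrier_vec d" using x \<Omega>(1) by auto
    have w: "?w \<in> carrier_vec d" using I xc by simp
    have nonneg: "0 \<le> 1 + ?\<Delta> $$ (i, i)" if "i < d" for i
      using row_bound[OF x that] by simp
    have "H *\<^sub>v ?w = x"
      using H I xc by (simp flip: assoc_mult_mat_vec[of _ d d _ d])
    then have "x $ j = (H *\<^sub>v ?w) $ j" by simp
    also have "\<dots> = (\<Sum>i<d. H $$ (j, i) * ?w $ i)"
      by (rule mult_mat_vec_index[OF H(1) w j])
    finally have "\<bar>x $ j\<bar> \<le> (\<Sum>i<d. \<bar>H $$ (j, i) * ?w $ i\<bar>)" by simp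
    also have "\<dots> \<le> (\<Sum>i<d. \<bar>H $$ (j, i)\<bar> * (1 + ?\<Delta> $$ (i, i)))"
      unfolding abs_mult by (intro sum_mono mult_left_mono) (use row_bound[OF x] in auto)
    also have "\<dots> \<le> B"
      unfolding B_def using j nonneg by (intro member_le_sum[of j]) (auto intro!: sum_nonneg)
    finally show ?thesis .
  qed
  then have "AE x in F. \<forall>i<d. \<bar>x $ i\<bar> \<le> B"
    using \<Omega>(2) by (auto elim!: eventually_mono)
  then show ?thesis by (rule that)
qed

section \<open>Entrywise convergence of matrices\<close>

text \<open>Membership in \<open>carrier_mat d d\<close> is demanded at every index, not just
  eventually, so that the entry formulas for products and transposes hold throughout. The price is
  that sequences have to be cut down to tails on which the alignment is specified.\<close>

definition mat_lim :: "nat \<Rightarrow> (nat \<Rightarrow> real mat) \<Rightarrow> real mat \<Rightarrow> bool" where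
  "mat_lim d M L \<longleftrightarrow> (\<forall>n. M n \<in> carrier_mat d d) \<and> L \<in> carrier_mat d d \<and>
     (\<forall>i<d. \<forall>j<d. (\<lambda>n. M n $$ (i, j)) \<longlonglongrightarrow> L $$ (i, j))"

lemma mat_limD:
  assumes "mat_lim d M L"
  shows "M n \<in> carrier_mat d d" "L \<in> carrier_mat d d"
    "i < d \<Longrightarrow> j < d \<Longrightarrow> (\<lambda>n. M n $$ (i, j)) \<longlonglongrightarrow> L $$ (i, j)"
  using assms by (auto simp: mat_lim_def)

lemma mat_lim_const: "A \<in> carrier_mat d d \<Longrightarrow> mat_lim d (\<lambda>_. A) A"
  by (simp add: mat_lim_def)

lemma mat_lim_mult:
  assumes "mat_lim d A a" "mat_lim d B b"
  shows "mat_lim d (\<lambda>n. A n * B n) (a * b)"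
  unfolding mat_lim_def
proof (intro conjI allI impI)
  note A = mat_limD[OF assms(1)] and B = mat_limD[OF assms(2)]
  show "A n * B n \<in> carrier_mat d d" "a * b \<in> carrier_mat d d" for n using A B by simp_all
  fix i j assume ij: "i < d" "j < d"
  show "(\<lambda>n. (A n * B n) $$ (i, j)) \<longlonglongrightarrow> (a * b) $$ (i, j)"
    unfolding mult_mat_index[OF A(1) B(1) ij] mult_mat_index[OF A(2) B(2) ij]
    by (intro tendsto_sum tendsto_mult A(3) B(3)) (use ij in auto)
qed

lemma mat_lim_transpose:
  assumes "mat_lim d A a"
  shows "mat_lim d (\<lambda>n. transpose_mat (A n)) (transpose_mat a)"
  unfolding mat_lim_def
proof (intro conjI allI impI)
  note A = mat_limD[OF assms]
  show "transpose_mat (A n) \<in> carrier_mat d d" "transpose_mat a \<in> carrier_mat d d" for n using A by simp_all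
  fix i j assume ij: "i < d" "j < d"
  have "(\<lambda>n. A n $$ (j, i)) \<longlonglongrightarrow> a $$ (j, i)" using A(3) ij by simp
  moreover have "A n \<in> carrier_mat d d" for n by (rule A)
  ultimately show "(\<lambda>n. transpose_mat (A n) $$ (i, j)) \<longlonglongrightarrow> transpose_mat a $$ (i, j)"
    using ij A(2) by (simp add: carrier_matD[OF A(1)])
qed

lemma mat_lim_unique:
  assumes "mat_lim d A a" "mat_lim d A b"
  shows "a = b"
proof (rule eq_matI)
  fix i j assume "i < dim_row b" "j < dim_col b"
  then have "i < d" "j < d" using mat_limD(2)[OF assms(2)] by auto
  then show "a $$ (i, j) = b $$ (i, j)" 
    using LIMSEQ_unique[OF mat_limD(3)[OF assms(1), of i j] mat_limD(3)[OF assms(2), of i j]] by simp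
qed (use mat_limD(2)[OF assms(1)] mat_limD(2)[OF assms(2)] in auto)

lemma mat_lim_subseq: "mat_lim d A a \<Longrightarrow> strict_mono r \<Longrightarrow> mat_lim d (\<lambda>n. A (r n)) a"
  using LIMSEQ_subseq_LIMSEQ[of "\<lambda>n. A n $$ (_, _)" _ r] by (auto simp: mat_lim_def o_def)

lemma mat_lim_mat_diag:
  assumes "\<And>i. i < d \<Longrightarrow> (\<lambda>n. f n i) \<longlonglongrightarrow> g i"
  shows "mat_lim d (\<lambda>n. mat_diag d (f n)) (mat_diag d g)"
  using assms by (auto simp: mat_lim_def mat_diag_def)

text \<open>By the Leibniz formula the determinant is a polynomial in the entries. An invertible
  limit thus makes the matrices eventually invertible.\<close>

lemma mat_lim_det:
  assumes "mat_lim d A a"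
  shows "(\<lambda>n. det (A n)) \<longlonglongrightarrow> det a"
proof -
  note A = mat_limD[OF assms]
  show ?thesis
    unfolding det_def'[OF A(1)] det_def'[OF A(2)]
    by (intro tendsto_sum tendsto_mult tendsto_const tendsto_prod A(3))
      (auto dest: permutes_in_image)
qed

text \<open>Bolzano-Weierstrass, one member of the family at a time; refining a subsequence keeps
  the earlier members convergent.\<close>

lemma bounded_family_convergent_subseq:
  fixes f :: "'k \<Rightarrow> nat \<Rightarrow> real"
  assumes "finite K" "\<And>k n. k \<in> K \<Longrightarrow> \<bar>f k n\<bar> \<le> B"
  shows "\<exists>r. strict_mono (r :: nat \<Rightarrow> nat) \<and> (\<forall>k\<in>K. convergent (\<lambda>n. f k (r n)))"
  using assms
proof (induction K rule: finite_induct)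
  case empty
  then show ?case by (intro exI[of _ id]) (auto simp: strict_mono_def)
next
  case (insert k K)
  then obtain r where r: "strict_mono r" "\<And>k. k \<in> K \<Longrightarrow> convergent (\<lambda>n. f k (r n))" by auto
  have "bounded (range (\<lambda>n. f k (r n)))"
    using insert.prems by (auto simp: bounded_iff)
  from bounded_imp_convergent_subsequence[OF this] obtain l s where
    s: "strict_mono s" "(\<lambda>n. f k (r (s n))) \<longlonglongrightarrow> l" by (auto simp: o_def)
  have "convergent (\<lambda>n. f k' (r (s n)))" if "k' \<in> insert k K" for k'
    using that s convergent_subseq_convergent[OF r(2) s(1), of k'] by (auto simp: convergent_def o_def)
  moreover have "strict_mono (\<lambda>n. r (s n))" using r(1) s(1) by (auto simp: strict_mono_def)
  ultimately show ?case by blast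
qed

lemma bounded_mat_convergent_subseq:
  assumes carrier: "\<And>n. M n \<in> carrier_mat d d"
    and bound: "\<And>n i j. i < d \<Longrightarrow> j < d \<Longrightarrow> \<bar>M n $$ (i, j)\<bar> \<le> B"
  obtains r L where "strict_mono (r :: nat \<Rightarrow> nat)" "mat_lim d (\<lambda>n. M (r n)) L"
proof -
  obtain r where r: "strict_mono (r :: nat \<Rightarrow> nat)"
    "\<And>k. k \<in> {..<d} \<times> {..<d} \<Longrightarrow> convergent (\<lambda>n. M (r n) $$ k)"
    using bounded_family_convergent_subseq[of "{..<d} \<times> {..<d}" "\<lambda>k n. M n $$ k" B] bound by auto
  have "mat_lim d (\<lambda>n. M (r n)) (mat d d (\<lambda>k. lim (\<lambda>n. M (r n) $$ k)))"
    using carrier r(2) by (auto simp: mat_lim_def convergent_LIMSEQ_iff)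
  with r(1) show ?thesis by (rule that)
qed

text \<open>Columns have length 1. This provides the compactness of the orthogonal group from which
  convergent subsequences are extracted.\<close>

lemma orthonormal_cols_entry_le_1:
  assumes "orthonormal_cols d d W" "i < d" "j < d"
  shows "\<bar>W $$ (i, j)\<bar> \<le> 1"
proof -
  have W: "W \<in> carrier_mat d d" "transpose_mat W * W = 1\<^sub>m d" using assms(1) by (auto simp: orthonormal_cols_def)
  have "(W $$ (i, j))\<^sup>2 \<le> (\<Sum>k<d. (W $$ (k, j))\<^sup>2)"
    using assms by (intro member_le_sum) auto
  also have "\<dots> = (transpose_mat W * W) $$ (j, j)"
    using W(1) assms(3) by (subst mult_mat_index[of _ d d _ d]) (auto simp: power2_eq_square)
  also have "\<dots> = 1" using W assms by simp
  finally show ?thesis by (simp add: abs_square_le_1)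
qed

text \<open>The upper bound also shows that the set under \<open>SUP\<close> is bounded, without
  which membership in the set would give no lower bound on the supremum. The bound on single entries
  comes from testing at unit vectors.\<close>

lemma spectral_norm_bounds:
  assumes A: "A \<in> carrier_mat d d"
  shows "i < d \<Longrightarrow> j < d \<Longrightarrow> \<bar>A $$ (i, j)\<bar> \<le> spectral_norm A"
    and "spectral_norm A \<le> (\<Sum>i<d. \<Sum>j<d. \<bar>A $$ (i, j)\<bar>)"
    and "0 \<le> spectral_norm A"
proof -
  let ?S = "{v \<in> carrier_vec (dim_col A). v \<bullet> v \<le> (1::real)}"
  let ?f = "\<lambda>v. sqrt ((A *\<^sub>v v) \<bullet> (A *\<^sub>v v))"
  have f_eq: "?f v = L2_set (\<lambda>i. (A *\<^sub>v v) $ i) {..<d}" if "v \<in> carrier_vec d" for v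
    using that A by (simp add: L2_set_def scalar_prod_sum[of _ d] power2_eq_square del: index_mult_mat_vec)
  have le: "?f v \<le> (\<Sum>i<d. \<Sum>j<d. \<bar>A $$ (i, j)\<bar>)" if v: "v \<in> ?S" for v
  proof -
    have vc: "v \<in> carrier_vec d" using v A by auto
    have "\<bar>v $ j\<bar> \<le> 1" if "j < d" for j
    proof -
      have "(v $ j)\<^sup>2 \<le> (\<Sum>k<d. (v $ k)\<^sup>2)" using that by (intro member_le_sum) auto
      also have "\<dots> = v \<bullet> v" using vc by (simp add: scalar_prod_sum power2_eq_square)
      also have "\<dots> \<le> 1" using v by simp
      finally show ?thesis by (simp add: abs_square_le_1)
    qed
    then have entry: "\<bar>(A *\<^sub>v v) $ i\<bar> \<le> (\<Sum>j<d. \<bar>A $$ (i, j)\<bar>)" if "i < d" for i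
      unfolding mult_mat_vec_index[OF A vc that]
      by (intro order.trans[OF sum_abs] sum_mono) (auto simp: abs_mult intro: mult_left_le)
    have "?f v \<le> (\<Sum>i<d. \<bar>(A *\<^sub>v v) $ i\<bar>)" unfolding f_eq[OF vc] by (rule L2_set_le_sum_abs)
    also have "\<dots> \<le> (\<Sum>i<d. \<Sum>j<d. \<bar>A $$ (i, j)\<bar>)" by (intro sum_mono entry) auto
    finally show ?thesis .
  qed
  have bdd: "bdd_above (?f ` ?S)" using le by (intro bdd_aboveI2)
  have zero: "0\<^sub>v d \<in> ?S" using A by auto
  have "0 \<le> ?f (0\<^sub>v d)" unfolding f_eq[OF zero_carrier_vec] by (rule L2_set_nonneg)
  also have "\<dots> \<le> spectral_norm A" unfolding spectral_norm_def by (rule cSUP_upper[OF zero bdd])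
  finally show "0 \<le> spectral_norm A" .
  from zero show "spectral_norm A \<le> (\<Sum>i<d. \<Sum>j<d. \<bar>A $$ (i, j)\<bar>)"
    unfolding spectral_norm_def by (intro cSUP_least le) blast
  show "\<bar>A $$ (i, j)\<bar> \<le> spectral_norm A" if ij: "i < d" "j < d"
  proof -
    have e: "unit_vec d j \<in> ?S" using A ij by auto
    have "A $$ (i, j) = (A *\<^sub>v unit_vec d j) $ i" using A ij by simp
    also have "\<bar>\<dots>\<bar> \<le> ?f (unit_vec d j)"
      unfolding f_eq[OF unit_vec_carrier]
      by (rule order.trans[OF _ member_le_L2_set[of "{..<d}" i "\<lambda>i. \<bar>(A *\<^sub>v unit_vec d j) $ i\<bar>", THEN order.trans]])
        (use ij in \<open>auto simp: L2_set_def\<close>)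
    also have "\<dots> \<le> spectral_norm A"
      unfolding spectral_norm_def by (rule cSUP_upper[OF e bdd])
    finally show ?thesis .
  qed
qed

text \<open>Matrix subtraction takes its dimensions from the second argument, so
  \<open>M n - L\<close> is \<open>d\<close> by \<open>d\<close> whatever the shape of
  \<open>M n\<close>. This matters because \<open>Q n\<close> is unrestricted as long as the data
  matrix lacks full rank.\<close>

lemma spectral_norm_tendsto_iff:
  assumes L: "L \<in> carrier_mat d d"
  shows "(\<lambda>n. spectral_norm (M n - L)) \<longlonglongrightarrow> 0 \<longleftrightarrow>
    (\<forall>i<d. \<forall>j<d. (\<lambda>n. M n $$ (i, j)) \<longlonglongrightarrow> L $$ (i, j))" (is "?lhs \<longleftrightarrow> ?rhs")
proof
  have carrier: "M n - L \<in> carrier_mat d d" for n using L by (rule minus_carrier_mat)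
  have entry: "(M n - L) $$ (i, j) = M n $$ (i, j) - L $$ (i, j)" if "i < d" "j < d" for n i j
    using that L by simp
  show ?rhs if ?lhs
  proof (intro allI impI)
    fix i j assume ij: "i < d" "j < d"
    have "(\<lambda>n. M n $$ (i, j) - L $$ (i, j)) \<longlonglongrightarrow> 0"
      by (rule Lim_null_comparison[OF _ that])
        (use spectral_norm_bounds(1)[OF carrier ij] entry[OF ij] in auto)
    then show "(\<lambda>n. M n $$ (i, j)) \<longlonglongrightarrow> L $$ (i, j)" by (simp add: LIM_zero_iff)
  qed
  show ?lhs if ?rhs
  proof (rule Lim_null_comparison)
    show "(\<lambda>n. \<Sum>i<d. \<Sum>j<d. \<bar>(M n - L) $$ (i, j)\<bar>) \<longlonglongrightarrow> 0"
    proof (intro tendsto_null_sum tendsto_rabs_zero)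
      fix i j assume "i \<in> {..<d}" "j \<in> {..<d}"
      then show "(\<lambda>n. (M n - L) $$ (i, j)) \<longlonglongrightarrow> 0" using that by (simp add: entry LIM_zero_iff)
    qed
    show "\<forall>\<^sub>F n in sequentially. norm (spectral_norm (M n - L)) \<le> (\<Sum>i<d. \<Sum>j<d. \<bar>(M n - L) $$ (i, j)\<bar>)"
      using spectral_norm_bounds(2,3)[OF carrier] by (auto intro!: always_eventually)
  qed
qed

section \<open>Spectra and commutants of diagonal matrices\<close>

lemma ordered_diag_eq_mat_diag:
  "ordered_diag d L \<Longrightarrow> L = mat_diag d (\<lambda>i. L $$ (i, i))"
  by (rule eq_matI) (auto simp: ordered_diag_def mat_diag_def diagonal_mat_def)

text \<open>The linear factors determine the multiset of roots, and a multiset has a single sorted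
  enumeration. Reversal turns the decreasing order of the eigenvalues into the increasing order of
  \<open>sort\<close>.\<close>

lemma ordered_roots_unique:
  fixes f g :: "nat \<Rightarrow> real"
  assumes eq: "(\<Prod>i<d. [:- f i, 1:]) = (\<Prod>i<d. [:- g i, 1:])"
    and f: "\<And>i j. i \<le> j \<Longrightarrow> j < d \<Longrightarrow> f j \<le> f i" and g: "\<And>i j. i \<le> j \<Longrightarrow> j < d \<Longrightarrow> g j \<le> g i"
    and i: "i < d"
  shows "f i = g i"
proof -
  have roots: "mset (rev (map h [0..<d])) = proots (\<Prod>i<d. [:- h i, 1:])" for h :: "nat \<Rightarrow> real"
  proof -
    have "proots (\<Prod>i<d. [:- h i, 1:]) = (\<Sum>i<d. {#h i#})"
      by (subst proots_prod) auto
    also have "\<dots> = mset (rev (map h [0..<d]))" by (induction d) auto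
    finally show ?thesis by simp
  qed
  have srt: "sorted (rev (map h [0..<d]))" if "\<And>i j. i \<le> j \<Longrightarrow> j < d \<Longrightarrow> h j \<le> h i" for h :: "nat \<Rightarrow> real"
    by (auto simp: sorted_iff_nth_mono rev_nth intro!: that)
  have "rev (map f [0..<d]) = rev (map g [0..<d])"
    using properties_for_sort[OF _ srt[of f], of "rev (map f [0..<d])"]
      properties_for_sort[OF _ srt[of g], of "rev (map f [0..<d])"] f g eq roots[of f] roots[of g] by metis
  then have "map f [0..<d] = map g [0..<d]" by simp
  from arg_cong[OF this, of "\<lambda>xs. xs ! i"] show ?thesis using i by simp
qed

lemma char_poly_mat_diag:
  fixes f :: "nat \<Rightarrow> real"
  shows "char_poly (mat_diag d f) = (\<Prod>i<d. [:- f i, 1:])"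
proof -
  have "diag_mat (mat_diag d f) = map f [0..<d]" by (auto simp: diag_mat_def mat_diag_def)
  moreover have "upper_triangular (mat_diag d f)" by (auto simp: mat_diag_def upper_triangular_def)
  ultimately have "char_poly (mat_diag d f) = (\<Prod>a\<leftarrow>map f [0..<d]. [:- a, 1:])"
    using char_poly_upper_triangular[of "mat_diag d f" d] by simp
  also have "\<dots> = (\<Prod>i<d. [:- f i, 1:])"
    by (simp add: prod.list_conv_set_nth lessThan_atLeast0)
  finally show ?thesis .
qed

text \<open>An invertible \<open>B\<close> conjugates \<open>C\<close> into \<open>A\<close>. The
  inverse-free form of the hypothesis survives limits and follows directly from
  \<open>D * D = \<Delta>\<close>.\<close>

lemma char_poly_intertwined:
  fixes A B C :: "real mat"
  assumes A: "A \<in> carrier_mat n n" and C: "C \<in> carrier_mat n n" and B: "B \<in> carrier_mat n n"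
    and det: "det B \<noteq> 0" and eq: "A * B = B * C"
  shows "char_poly A = char_poly C"
proof -
  obtain B' where B': "B' \<in> carrier_mat n n" "B * B' = 1\<^sub>m n" "B' * B = 1\<^sub>m n"
    using real_mat_inverse[OF B det] by blast
  have "A = A * (B * B')" using A B' by simp
  also have "\<dots> = B * C * B'" using A B B'(1) by (simp only: assoc_mult_mat[of A n n B n B' n, symmetric] eq)
  finally have "similar_mat A C" using A B B' C by (intro similar_matI[of _ _ B B' n]) auto
  then show ?thesis by (rule char_poly_similar)
qed

text \<open>Comparing entries, \<open>W $$ (i, j)\<close> can be nonzero only if
  \<open>l i = l j\<close>, and then \<open>h (l i) = h (l j)\<close>.\<close>

lemma commute_mat_diag_fun:
  assumes W: "W \<in> carrier_mat d d" and comm: "W * mat_diag d l = mat_diag d l * (W :: real mat)"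
  shows "W * mat_diag d (\<lambda>i. h (l i)) = mat_diag d (\<lambda>i. h (l i)) * W"
proof -
  have "W $$ (i, j) * h (l j) = h (l i) * W $$ (i, j)" if ij: "i < d" "j < d" for i j
  proof -
    have "W $$ (i, j) * l j = l i * W $$ (i, j)"
      using arg_cong[OF comm, of "\<lambda>M. M $$ (i, j)"] ij
      by (simp add: mat_diag_mult_left[OF W] mat_diag_mult_right[OF W])
    then show ?thesis by (cases "W $$ (i, j) = 0") auto
  qed
  then show ?thesis by (auto simp: mat_diag_mult_left[OF W] mat_diag_mult_right[OF W])
qed

section \<open>Limits of the spectral embedding\<close>

lemma mat_diag_cong: "(\<And>i. i < d \<Longrightarrow> f i = g i) \<Longrightarrow> mat_diag d f = mat_diag d g"
  by (auto simp: mat_diag_def)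

lemma transpose_mat_diag [simp]: "transpose_mat (mat_diag d f) = mat_diag d f"
  by (auto simp: mat_diag_def)

text \<open>Write \<open>S\<close> for the signs of \<open>l\<close>, so that
  \<open>S \<bar>l\<bar> = l\<close>. Inserting the expression for \<open>G\<close> gives
  \<open>Q I G = (Q I Q\<^sup>T) \<bar>l\<bar> Q = l Q\<close>; multiplying by
  \<open>I Q\<^sup>T S\<close> and using \<open>S S = 1\<close> gives the second equation. The
  latter writes the eigenvalues as a product of factors that converge along a subsequence, which
  makes them converge too.\<close>

lemma sgn_gram_identities:
  fixes I Q G :: "real mat"
  assumes I: "I \<in> carrier_mat d d" and Q: "Q \<in> carrier_mat d d"
    and l: "\<And>i. i < d \<Longrightarrow> l i \<noteq> 0"
    and QI: "Q * I * transpose_mat Q = mat_diag d (\<lambda>i. sgn (l i))"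
    and QG: "transpose_mat Q * mat_diag d (\<lambda>i. \<bar>l i\<bar>) * Q = G"
  shows "mat_diag d l * Q = Q * (I * G)"
    and "mat_diag d l = Q * (I * G) * (I * (transpose_mat Q * mat_diag d (\<lambda>i. sgn (l i))))"
proof -
  define S where "S = mat_diag d (\<lambda>i. sgn (l i))"
  define B where "B = mat_diag d (\<lambda>i. \<bar>l i\<bar>)"
  have c: "S \<in> carrier_mat d d" "B \<in> carrier_mat d d" "transpose_mat Q \<in> carrier_mat d d"
    using Q by (simp_all add: S_def B_def)
  have SS: "S * S = 1\<^sub>m d"
    unfolding S_def mat_diag_diag mat_diag_one[symmetric]
    by (rule mat_diag_cong) (use l in \<open>auto simp: sgn_if\<close>)
  have SB: "S * B = mat_diag d l"
    unfolding S_def B_def mat_diag_diag by (rule mat_diag_cong) (simp add: sgn_mult_abs)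
  have "Q * (I * G) = (Q * I * transpose_mat Q) * (B * Q)"
    unfolding QG[symmetric] B_def[symmetric] using I Q c by (simp add: assoc_mult_mat[of _ d d _ d _ d])
  also have "\<dots> = (S * B) * Q"
    unfolding QI S_def[symmetric] using Q c by (simp add: assoc_mult_mat[of _ d d _ d _ d])
  finally show LQ: "mat_diag d l * Q = Q * (I * G)" unfolding SB by simp
  have "Q * (I * G) * (I * (transpose_mat Q * S)) = mat_diag d l * ((Q * I * transpose_mat Q) * S)"
    unfolding LQ[symmetric] using I Q c by (simp add: assoc_mult_mat[of _ d d _ d _ d])
  also have "\<dots> = mat_diag d l"
    unfolding QI S_def[symmetric] SS by simp
  finally show "mat_diag d l = Q * (I * G) * (I * (transpose_mat Q * mat_diag d (\<lambda>i. sgn (l i))))"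
    by (simp add: S_def)
qed

lemma orthonormal_cols_mat_lim:
  assumes "\<And>n. orthonormal_cols d d (W n)" "mat_lim d W V"
  shows "orthonormal_cols d d V"
proof -
  have "transpose_mat V * V = 1\<^sub>m d"
  proof (rule mat_lim_unique)
    show "mat_lim d (\<lambda>n. transpose_mat (W n) * W n) (transpose_mat V * V)"
      using assms(2) by (intro mat_lim_mult mat_lim_transpose)
    show "mat_lim d (\<lambda>n. transpose_mat (W n) * W n) (1\<^sub>m d)"
      using assms(1) by (simp add: orthonormal_cols_def mat_lim_const)
  qed
  then show ?thesis using mat_limD(2)[OF assms(2)] by (simp add: orthonormal_cols_def)
qed

lemma ordered_diag_mat_lim:
  assumes L: "\<And>n. ordered_diag d (L n)" and lim: "mat_lim d L K"
  shows "ordered_diag d K"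
proof -
  note K = mat_limD[OF lim]
  have "K $$ (i, j) = 0" if "i < d" "j < d" "i \<noteq> j" for i j
  proof (rule LIMSEQ_unique[OF K(3)[OF that(1,2)]])
    have "L n $$ (i, j) = 0" for n
      using L[of n] that by (auto simp: ordered_diag_def diagonal_mat_def)
    then show "(\<lambda>n. L n $$ (i, j)) \<longlonglongrightarrow> 0" by simp
  qed
  moreover have "K $$ (j, j) \<le> K $$ (i, i)" if ij: "i \<le> j" "j < d" for i j
  proof (rule LIMSEQ_le[OF K(3) K(3)])
    show "\<exists>N. \<forall>n\<ge>N. L n $$ (j, j) \<le> L n $$ (i, i)"
      using L ij by (auto simp: ordered_diag_def)
  qed (use ij in auto)
  ultimately show ?thesis using K(2) by (auto simp: ordered_diag_def diagonal_mat_def)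
qed

text \<open>Along a subsequence on which \<open>W\<close> and the signs of \<open>L\<close> converge, \<open>Q\<close> and \<open>L\<close> converge too.
  The limit of \<open>L\<close> is similar to \<open>I \<Delta>\<close> and ordered, hence it is \<open>\<Lambda>\<close>.\<close>

lemma embedding_limit:
  fixes I \<Delta> \<Lambda> K :: "real mat"
  assumes I: "I \<in> carrier_mat d d"
    and G: "mat_lim d G \<Delta>" and det: "det \<Delta> \<noteq> 0"
    and L: "\<And>n. ordered_diag d (L n)" "\<And>n i. i < d \<Longrightarrow> L n $$ (i, i) \<noteq> 0"
    and Q: "\<And>n. Q n \<in> carrier_mat d d"
    and QI: "\<And>n. Q n * I * transpose_mat (Q n) = mat_diag d (\<lambda>i. sgn (L n $$ (i, i)))"
    and QG: "\<And>n. transpose_mat (Q n) * mat_diag d (\<lambda>i. \<bar>L n $$ (i, i)\<bar>) * Q n = G n"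
    and \<Lambda>: "ordered_diag d \<Lambda>" "char_poly (I * \<Delta>) = (\<Prod>i<d. [:- \<Lambda> $$ (i, i), 1:])"
    and W: "\<And>n. block_orthogonal \<Lambda> (W n)"
    and WQ: "mat_lim d (\<lambda>n. W n * Q n) K"
  shows "transpose_mat K * mat_diag d (\<lambda>i. \<bar>\<Lambda> $$ (i, i)\<bar>) * K = \<Delta>"
    and "transpose_mat K * mat_diag d (\<lambda>i. \<bar>\<Lambda> $$ (i, i)\<bar> * \<Lambda> $$ (i, i)) * K = \<Delta> * I * \<Delta>"
proof -
  have \<Lambda>c: "\<Lambda> \<in> carrier_mat d d" using \<Lambda>(1) by (simp add: ordered_diag_def)
  have \<Delta>: "\<Delta> \<in> carrier_mat d d" by (rule mat_limD(2)[OF G])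
  have Worth: "orthonormal_cols d d (W n)" and Wcomm: "W n * \<Lambda> = \<Lambda> * W n" for n
    using W[of n] \<Lambda>c by (auto simp: block_orthogonal_def)
  note Wd = orthonormal_colsD[OF Worth]
  \<comment> \<open>The signs are not shown to be constant in \<open>n\<close>. They are bounded, so
    a further subsequence makes them converge.\<close>
  define S where "S n = mat_diag d (\<lambda>i. sgn (L n $$ (i, i)))" for n
  obtain r1 V where r1: "strict_mono r1" and V1: "mat_lim d (\<lambda>n. W (r1 n)) V"
    using bounded_mat_convergent_subseq[of W d 1] Wd(1) orthonormal_cols_entry_le_1[OF Worth] by metis
  have "\<bar>S (r1 n) $$ (i, j)\<bar> \<le> 1" if "i < d" "j < d" for n i j
    using that by (simp add: S_def mat_diag_def sgn_if)
  moreover have "S (r1 n) \<in> carrier_mat d d" for n by (simp add: S_def)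
  ultimately obtain r2 T where r2: "strict_mono r2" and T: "mat_lim d (\<lambda>n. S (r1 (r2 n))) T"
    using bounded_mat_convergent_subseq[of "\<lambda>n. S (r1 n)" d 1] by metis
  define r where "r n = r1 (r2 n)" for n
  have r: "strict_mono r" using r1 r2 by (auto simp: strict_mono_def r_def)
  have V: "mat_lim d (\<lambda>n. W (r n)) V" using mat_lim_subseq[OF V1 r2] by (simp add: r_def)
  have T: "mat_lim d (\<lambda>n. S (r n)) T" using T by (simp add: r_def)
  note VD = orthonormal_colsD[OF orthonormal_cols_mat_lim[OF Worth V]]
  have Vcomm: "V * \<Lambda> = \<Lambda> * V"
  proof (rule mat_lim_unique)
    show "mat_lim d (\<lambda>n. W (r n) * \<Lambda>) (V * \<Lambda>)" by (intro mat_lim_mult V mat_lim_const \<Lambda>c)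
    show "mat_lim d (\<lambda>n. W (r n) * \<Lambda>) (\<Lambda> * V)"
      unfolding Wcomm by (intro mat_lim_mult V mat_lim_const \<Lambda>c)
  qed
  have K: "K \<in> carrier_mat d d" by (rule mat_limD(2)[OF WQ])
  \<comment> \<open>\<open>R\<close> undoes the limiting rotation: it is the limit of
    \<open>Q\<close> itself along the subsequence.\<close>
  define R where "R = transpose_mat V * K"
  have Rc: "R \<in> carrier_mat d d" using VD K by (simp add: R_def)
  have KR: "K = V * R"
    unfolding R_def using VD K by (simp flip: assoc_mult_mat[of V d d _ d K d])
  have Rlim: "mat_lim d (\<lambda>n. Q (r n)) R"
  proof -
    have "Q n = transpose_mat (W n) * (W n * Q n)" for n
    proof -
      have "transpose_mat (W n) * (W n * Q n) = (transpose_mat (W n) * W n) * Q n"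
        using Wd(1) Q by (intro assoc_mult_mat[symmetric, of _ d d _ d _ d]) auto
      then show ?thesis using Wd(2) Q by simp
    qed
    then have "(\<lambda>n. Q (r n)) = (\<lambda>n. transpose_mat (W (r n)) * (W (r n) * Q (r n)))" by blast
    then show ?thesis
      unfolding R_def using mat_lim_mult[OF mat_lim_transpose[OF V] mat_lim_subseq[OF WQ r]] by simp
  qed
  have Glim: "mat_lim d (\<lambda>n. G (r n)) \<Delta>" by (rule mat_lim_subseq[OF G r])
  have Ld: "L n = mat_diag d (\<lambda>i. L n $$ (i, i))" for n by (rule ordered_diag_eq_mat_diag[OF L(1)])
  have ids: "L n * Q n = Q n * (I * G n)"
    "L n = Q n * (I * G n) * (I * (transpose_mat (Q n) * S n))" for n
    using sgn_gram_identities[OF I Q L(2) QI QG, of n, folded Ld] by (auto simp: S_def)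
  \<comment> \<open>The second equation of \<open>ids\<close> with every factor replaced by its
    limit.\<close>
  define M where "M = R * (I * \<Delta>) * (I * (transpose_mat R * T))"
  have Llim: "mat_lim d (\<lambda>n. L (r n)) M"
  proof -
    have "(\<lambda>n. L (r n)) = (\<lambda>n. Q (r n) * (I * G (r n)) * (I * (transpose_mat (Q (r n)) * S (r n))))"
      using ids(2) by blast
    then show ?thesis
      unfolding M_def
      by (simp only:) (intro mat_lim_mult Rlim mat_lim_const I Glim mat_lim_transpose T)
  qed
  note MD = ordered_diag_mat_lim[OF L(1) Llim]
  have Mc: "M \<in> carrier_mat d d" by (rule mat_limD(2)[OF Llim])
  have MR: "M * R = R * (I * \<Delta>)"
  proof (rule mat_lim_unique)
    show "mat_lim d (\<lambda>n. L (r n) * Q (r n)) (M * R)" by (intro mat_lim_mult Llim Rlim)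
    show "mat_lim d (\<lambda>n. L (r n) * Q (r n)) (R * (I * \<Delta>))"
      unfolding ids(1) by (intro mat_lim_mult Rlim mat_lim_const I Glim)
  qed
  define N where "N = mat_diag d (\<lambda>i. \<bar>M $$ (i, i)\<bar>)"
  have N: "N \<in> carrier_mat d d" by (simp add: N_def)
  have RNR: "transpose_mat R * N * R = \<Delta>"
  proof (rule mat_lim_unique[OF _ Glim])
    show "mat_lim d (\<lambda>n. G (r n)) (transpose_mat R * N * R)"
      unfolding QG[symmetric] N_def
      by (intro mat_lim_mult mat_lim_transpose Rlim mat_lim_mat_diag tendsto_rabs mat_limD(3)[OF Llim])
  qed
  \<comment> \<open>Invertibility of \<open>\<Delta>\<close> passes to \<open>R\<close> by
    \<open>RNR\<close>, and then \<open>MR\<close> is a similarity between \<open>M\<close> and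
    \<open>I * \<Delta>\<close>.\<close>
  have "det (transpose_mat R * N) * det R = det \<Delta>"
    unfolding RNR[symmetric] using Rc N by (intro det_mult[symmetric]) auto
  then have detR: "det R \<noteq> 0" using det by auto
  have "char_poly M = char_poly (I * \<Delta>)"
    by (rule char_poly_intertwined[OF Mc _ Rc detR MR]) (use I \<Delta> in simp)
  moreover have "char_poly M = (\<Prod>i<d. [:- M $$ (i, i), 1:])"
    by (subst ordered_diag_eq_mat_diag[OF MD]) (rule char_poly_mat_diag)
  ultimately have "M $$ (i, i) = \<Lambda> $$ (i, i)" if "i < d" for i
    using that MD \<Lambda> by (intro ordered_roots_unique[where d = d and f = "\<lambda>i. M $$ (i, i)" and g = "\<lambda>i. \<Lambda> $$ (i, i)"]) (auto simp: ordered_diag_def)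
  then have diag_eq: "mat_diag d (\<lambda>i. h (\<Lambda> $$ (i, i))) = mat_diag d (\<lambda>i. h (M $$ (i, i)))" for h :: "real \<Rightarrow> real"
    by (intro mat_diag_cong) simp
  \<comment> \<open>The rotation \<open>V\<close> commutes with every function of
    \<open>\<Lambda>\<close> and drops out. Both conclusions are instances: \<open>h x\<close> is
    \<open>\<bar>x\<bar>\<close> in the first and \<open>\<bar>x\<bar> * x\<close> in the
    second.\<close>
  have reduce: "transpose_mat K * mat_diag d (\<lambda>i. h (\<Lambda> $$ (i, i))) * K =
      transpose_mat R * mat_diag d (\<lambda>i. h (M $$ (i, i))) * R" for h
  proof -
    define E where "E = mat_diag d (\<lambda>i. h (\<Lambda> $$ (i, i)))"
    have E: "E \<in> carrier_mat d d" by (simp add: E_def)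
    have "V * mat_diag d (\<lambda>i. \<Lambda> $$ (i, i)) = mat_diag d (\<lambda>i. \<Lambda> $$ (i, i)) * V"
      using Vcomm ordered_diag_eq_mat_diag[OF \<Lambda>(1)] by simp
    then have VE: "E * V = V * E" unfolding E_def by (rule commute_mat_diag_fun[OF VD(1), symmetric])
    have "transpose_mat K * E * K = transpose_mat R * (transpose_mat V * ((E * V) * R))"
      unfolding KR using VD(1) Rc E
      by (simp add: transpose_mult[of _ d d _ d] assoc_mult_mat[of _ d d _ d _ d])
    also have "\<dots> = transpose_mat R * ((transpose_mat V * V) * (E * R))"
      unfolding VE using VD(1) Rc E by (simp add: assoc_mult_mat[of _ d d _ d _ d])
    also have "\<dots> = transpose_mat R * E * R"
      using VD Rc E by (simp add: assoc_mult_mat[of _ d d _ d _ d])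
    finally show ?thesis unfolding E_def diag_eq .
  qed
  show "transpose_mat K * mat_diag d (\<lambda>i. \<bar>\<Lambda> $$ (i, i)\<bar>) * K = \<Delta>"
    using reduce[of abs] RNR by (simp add: N_def)
  have "mat_diag d (\<lambda>i. \<bar>M $$ (i, i)\<bar> * M $$ (i, i)) = N * M"
    unfolding N_def by (subst (2) ordered_diag_eq_mat_diag[OF MD]) simp
  then have "transpose_mat K * mat_diag d (\<lambda>i. \<bar>\<Lambda> $$ (i, i)\<bar> * \<Lambda> $$ (i, i)) * K = transpose_mat R * (N * M) * R"
    using reduce[of "\<lambda>x. \<bar>x\<bar> * x"] by simp
  also have "\<dots> = transpose_mat R * N * (M * R)"
    using Rc N Mc by (simp add: assoc_mult_mat[of _ d d _ d _ d])
  also have "\<dots> = (transpose_mat R * N * R) * (I * \<Delta>)"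
    unfolding MR using Rc N I \<Delta> by (simp add: assoc_mult_mat[of _ d d _ d _ d])
  also have "\<dots> = \<Delta> * I * \<Delta>"
    unfolding RNR using I \<Delta> by (simp add: assoc_mult_mat[of _ d d _ d _ d])
  finally show "transpose_mat K * mat_diag d (\<lambda>i. \<bar>\<Lambda> $$ (i, i)\<bar> * \<Lambda> $$ (i, i)) * K = \<Delta> * I * \<Delta>" .
qed

lemma det_mat_diag: "det (mat_diag d f) = (\<Prod>i<d. f i :: real)"
proof -
  have "upper_triangular (mat_diag d f)" by (auto simp: mat_diag_def upper_triangular_def)
  then have "det (mat_diag d f) = prod_list (diag_mat (mat_diag d f))"
    by (intro det_upper_triangular[of _ d]) auto
  also have "diag_mat (mat_diag d f) = map f [0..<d]" by (auto simp: diag_mat_def mat_diag_def)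
  finally show ?thesis by (simp add: prod.list_conv_set_nth lessThan_atLeast0)
qed

lemma abs_diag_powr_carrier: "L \<in> carrier_mat d d \<Longrightarrow> abs_diag_powr L r \<in> carrier_mat d d"
  by (auto simp: abs_diag_powr_def)

lemma abs_diag_powr_eq: "L \<in> carrier_mat d d \<Longrightarrow> abs_diag_powr L r = mat_diag d (\<lambda>i. \<bar>L $$ (i, i)\<bar> powr r)"
  by (auto simp: abs_diag_powr_def)

text \<open>Let \<open>b\<close> be the square root of \<open>\<bar>L\<bar>\<close>. Orthonormality
  of \<open>U\<close> gives \<open>U\<^sup>T X = b Q\<close>, hence
  \<open>X\<^sup>T X = X\<^sup>T U b Q = Q\<^sup>T b b Q\<close>. Computing
  \<open>U\<^sup>T (X J X\<^sup>T) U\<close> once from this and once from the eigendecomposition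
  gives \<open>b (Q J Q\<^sup>T) b = L\<close>; cancelling \<open>b\<close> on both sides leaves the
  signs.\<close>

lemma embedding_gram_identities:
  assumes X: "X \<in> carrier_mat n d" and J: "J \<in> carrier_mat d d"
    and dec: "nonzero_eigendecomposition d (X * J * transpose_mat X) U L"
    and Q: "Q \<in> carrier_mat d d" and UQ: "U * abs_diag_powr L (1/2) * Q = X"
  shows "Q * J * transpose_mat Q = mat_diag d (\<lambda>i. sgn (L $$ (i, i)))"
    and "transpose_mat Q * mat_diag d (\<lambda>i. \<bar>L $$ (i, i)\<bar>) * Q = transpose_mat X * X"
proof -
  have U: "U \<in> carrier_mat n d" "transpose_mat U * U = 1\<^sub>m d" and od: "ordered_diag d L"
    and nz: "\<And>i. i < d \<Longrightarrow> L $$ (i, i) \<noteq> 0"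
    and P: "X * J * transpose_mat X = U * L * transpose_mat U"
    using dec X by (auto simp: nonzero_eigendecomposition_def orthonormal_cols_def)
  have Lc: "L \<in> carrier_mat d d" using od by (simp add: ordered_diag_def)
  define b where "b = abs_diag_powr L (1/2)"
  define b' where "b' = abs_diag_powr L (-1/2)"
  have b: "b \<in> carrier_mat d d" "b' \<in> carrier_mat d d" using Lc by (simp_all add: b_def b'_def abs_diag_powr_carrier)
  have bT: "transpose_mat b = b" using Lc by (simp add: b_def abs_diag_powr_eq)
  have bb: "b * b = mat_diag d (\<lambda>i. \<bar>L $$ (i, i)\<bar>)"
    unfolding b_def abs_diag_powr_eq[OF Lc] mat_diag_diag by (rule mat_diag_cong) (simp flip: powr_add)
  have b'b: "b' * b = 1\<^sub>m d" "b * b' = 1\<^sub>m d"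
    unfolding b_def b'_def abs_diag_powr_eq[OF Lc] mat_diag_diag mat_diag_one[symmetric]
    by (rule mat_diag_cong, use nz in \<open>simp flip: powr_add\<close>)+
  have UX: "transpose_mat U * X = b * Q"
  proof -
    have "transpose_mat U * X = (transpose_mat U * U) * (b * Q)"
      unfolding UQ[symmetric] b_def[symmetric] using U(1) b(1) Q
      by (simp add: assoc_mult_mat[of _ d n _ d _ d] assoc_mult_mat[of _ n d _ d _ d])
    then show ?thesis using U b Q by simp
  qed
  have XU: "transpose_mat X * U = transpose_mat Q * b"
    using arg_cong[OF UX, of transpose_mat] U X b Q bT
    by (simp add: transpose_mult[of _ d n _ d] transpose_mult[of _ d d _ d])
  have "transpose_mat X * X = transpose_mat X * (U * (b * Q))"
    using UQ U(1) b(1) Q by (simp add: b_def assoc_mult_mat[of _ n d _ d _ d])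
  also have "\<dots> = (transpose_mat X * U) * (b * Q)"
    using X U(1) b(1) Q by (intro assoc_mult_mat[symmetric, of _ d n _ d _ d]) auto
  also have "\<dots> = transpose_mat Q * (b * b) * Q"
    unfolding XU using b(1) Q by (simp add: assoc_mult_mat[of _ d d _ d _ d])
  finally show "transpose_mat Q * mat_diag d (\<lambda>i. \<bar>L $$ (i, i)\<bar>) * Q = transpose_mat X * X"
    by (simp add: bb)
  have "b * (Q * J * transpose_mat Q) * b = (b * Q) * J * (transpose_mat Q * b)"
    using b(1) Q J by (simp add: assoc_mult_mat[of _ d d _ d _ d])
  also have "\<dots> = transpose_mat U * (X * J * transpose_mat X) * U"
    unfolding UX[symmetric] XU[symmetric] using X U(1) J
    by (simp add: assoc_mult_mat[of _ d n _ d _ d] assoc_mult_mat[of _ n d _ n _ d] assoc_mult_mat[of _ n d _ d _ n]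
        assoc_mult_mat[of _ d d _ n _ d] assoc_mult_mat[of _ d n _ n _ d] assoc_mult_mat[of _ n d _ d _ d]
        assoc_mult_mat[of _ d n _ d _ n] mult_carrier_mat[of _ d n _ d] mult_carrier_mat[of _ n d _ d] mult_carrier_mat[of _ d d _ n] mult_carrier_mat[of _ n d _ n])
  also have "\<dots> = (transpose_mat U * U) * L * (transpose_mat U * U)"
    unfolding P using U(1) Lc
    by (simp add: assoc_mult_mat[of _ d n _ d _ d] assoc_mult_mat[of _ n d _ n _ d] assoc_mult_mat[of _ n d _ d _ n]
        assoc_mult_mat[of _ d d _ n _ d] assoc_mult_mat[of _ d n _ n _ d] assoc_mult_mat[of _ n d _ d _ d]
        assoc_mult_mat[of _ d n _ d _ n] mult_carrier_mat[of _ d n _ d] mult_carrier_mat[of _ n d _ d] mult_carrier_mat[of _ d d _ n] mult_carrier_mat[of _ n d _ n])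
  also have "\<dots> = L" using U(2) Lc by simp
  finally have bQb: "b * (Q * J * transpose_mat Q) * b = L" .
  define Y where "Y = Q * J * transpose_mat Q"
  have Y: "Y \<in> carrier_mat d d" using Q J by (simp add: Y_def)
  have "Y = (b' * b) * Y * (b * b')" unfolding b'b using Y by simp
  also have "\<dots> = b' * (b * Y * b) * b'"
    using b Y by (simp add: assoc_mult_mat[of _ d d _ d _ d])
  also have "\<dots> = b' * L * b'" unfolding Y_def bQb ..
  also have "\<dots> = mat_diag d (\<lambda>i. sgn (L $$ (i, i)))"
  proof -
    have "b' * L * b' = b' * mat_diag d (\<lambda>i. L $$ (i, i)) * b'"
      using ordered_diag_eq_mat_diag[OF od] by simp
    also have "\<dots> = mat_diag d (\<lambda>i. \<bar>L $$ (i, i)\<bar> powr (-1/2) * L $$ (i, i) * \<bar>L $$ (i, i)\<bar> powr (-1/2))"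
      unfolding b'_def abs_diag_powr_eq[OF Lc] mat_diag_diag ..
    also have "\<dots> = mat_diag d (\<lambda>i. sgn (L $$ (i, i)))"
    proof (rule mat_diag_cong)
      fix i assume i: "i < d"
      have "\<bar>L $$ (i, i)\<bar> powr (-1/2) * \<bar>L $$ (i, i)\<bar> powr (-1/2) = \<bar>L $$ (i, i)\<bar> powr (-1)"
        by (simp flip: powr_add)
      also have "\<dots> = 1 / \<bar>L $$ (i, i)\<bar>" using nz[OF i] by (simp add: powr_minus divide_inverse)
      finally have "\<bar>L $$ (i, i)\<bar> powr (-1/2) * L $$ (i, i) * \<bar>L $$ (i, i)\<bar> powr (-1/2) = L $$ (i, i) / \<bar>L $$ (i, i)\<bar>"
        by (simp add: mult_ac)
      then show "\<bar>L $$ (i, i)\<bar> powr (-1/2) * L $$ (i, i) * \<bar>L $$ (i, i)\<bar> powr (-1/2) = sgn (L $$ (i, i))"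
        by (simp add: sgn_if)
    qed
    finally show ?thesis .
  qed
  finally show "Q * J * transpose_mat Q = mat_diag d (\<lambda>i. sgn (L $$ (i, i)))" unfolding Y_def .
qed

text \<open>A vector annihilated by \<open>X\<close> is annihilated by the Gram matrix, so an
  invertible Gram matrix makes the columns of \<open>X\<close> independent.\<close>

lemma rank_eq_of_det_gram:
  fixes X :: "real mat"
  assumes X: "X \<in> carrier_mat n d" and det: "det (transpose_mat X * X) \<noteq> 0"
  shows "vec_space.rank n X = d"
proof -
  interpret vec_space "TYPE(real)" n .
  let ?G = "transpose_mat X * X"
  have G: "?G \<in> carrier_mat d d" using X by (simp add: mult_carrier_mat[of _ d n _ d])
  have inj: "v = 0\<^sub>v d" if v: "v \<in> carrier_vec d" "X *\<^sub>v v = 0\<^sub>v n" for v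
  proof (rule ccontr)
    assume "v \<noteq> 0\<^sub>v d"
    moreover have "?G *\<^sub>v v = 0\<^sub>v d"
      using X v by (auto simp: assoc_mult_mat_vec[of _ d n _ d])
    ultimately show False using det det_0_iff_vec_prod_zero[OF G] v(1) by auto
  qed
  \<comment> \<open>\<open>lin_indpt\<close> speaks about the set of columns and would not notice a
    repetition. Two equal columns would put a difference of unit vectors into the kernel.\<close>
  have dist: "distinct (cols X)"
    unfolding distinct_conv_nth
  proof (intro allI impI notI)
    fix i j assume ij: "i < length (cols X)" "j < length (cols X)" "i \<noteq> j" "cols X ! i = cols X ! j"
    then have ijd: "i < d" "j < d" using X by auto
    have eq: "col X i = col X j" using ij by simp
    have "X *\<^sub>v (unit_vec d i - unit_vec d j) = X *\<^sub>v unit_vec d i - X *\<^sub>v unit_vec d j"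
      using X by (intro mult_minus_distrib_mat_vec) auto
    also have "\<dots> = col X i - col X j"
    proof -
      have "X *\<^sub>v unit_vec d k = col X k" if "k < d" for k
        using X that by (intro eq_vecI) auto
      then show ?thesis using ijd by simp
    qed
    also have "\<dots> = 0\<^sub>v n" unfolding eq using X by (intro eq_vecI) auto
    finally have "unit_vec d i - unit_vec d j = (0\<^sub>v d :: real vec)" by (intro inj) auto
    from arg_cong[OF this, of "\<lambda>v. v $ i"] show False using ijd ij(3) by simp
  qed
  have "lin_indpt (set (cols X))"
    using lin_depE[OF X _ dist] inj by metis
  from lin_indpt_full_rank[OF X dist this] show ?thesis .
qed

text \<open>Let \<open>E\<close> be the inverse of \<open>D\<close> and multiply both equations by
  \<open>E\<close> on both sides. The first becomes \<open>V V\<^sup>T = E \<Delta> E = 1\<close>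
  and the second \<open>V \<Lambda> V\<^sup>T = E \<Delta> J \<Delta> E = D J D\<close>.\<close>

lemma limit_eigenvector_form:
  assumes D: "D \<in> carrier_mat d d" "transpose_mat D = D" "D * D = \<Delta>" "det D \<noteq> 0"
    and J: "J \<in> carrier_mat d d" and \<Lambda>: "ordered_diag d \<Lambda>" and K: "K \<in> carrier_mat d d"
    and K1: "transpose_mat K * mat_diag d (\<lambda>i. \<bar>\<Lambda> $$ (i, i)\<bar>) * K = \<Delta>"
    and K2: "transpose_mat K * mat_diag d (\<lambda>i. \<bar>\<Lambda> $$ (i, i)\<bar> * \<Lambda> $$ (i, i)) * K = \<Delta> * J * \<Delta>"
  shows "\<exists>V. eigenvector_mat (D * J * D) \<Lambda> V \<and> K = abs_diag_powr \<Lambda> (-1/2) * transpose_mat V * D"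
proof -
  have \<Lambda>c: "\<Lambda> \<in> carrier_mat d d" using \<Lambda> by (simp add: ordered_diag_def)
  obtain E where E: "E \<in> carrier_mat d d" "D * E = 1\<^sub>m d" "E * D = 1\<^sub>m d"
    using real_mat_inverse[OF D(1,4)] by blast
  have "transpose_mat E = transpose_mat E * (D * E)" using E by simp
  also have "\<dots> = transpose_mat (D * E) * E"
    using D E(1) by (simp add: transpose_mult[of _ d d _ d] assoc_mult_mat[of _ d d _ d _ d])
  also have "\<dots> = E" using E by simp
  finally have ET: "transpose_mat E = E" .
  \<comment> \<open>Taking determinants in \<open>K1\<close> shows that no diagonal entry of
    \<open>\<Lambda>\<close> vanishes, which makes \<open>h'\<close> an inverse of
    \<open>h\<close>.\<close>
  have "det \<Delta> \<noteq> 0" using D(1,4) by (simp add: det_mult[of _ d] flip: D(3))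
  moreover have "det \<Delta> = det (transpose_mat K) * (\<Prod>i<d. \<bar>\<Lambda> $$ (i, i)\<bar>) * det K"
    unfolding K1[symmetric] using K by (simp add: det_mult[of _ d] det_mat_diag)
  ultimately have nz: "\<Lambda> $$ (i, i) \<noteq> 0" if "i < d" for i using that by auto
  define h where "h = abs_diag_powr \<Lambda> (1/2)"
  define h' where "h' = abs_diag_powr \<Lambda> (-1/2)"
  have h: "h \<in> carrier_mat d d" "h' \<in> carrier_mat d d" "transpose_mat h = h"
    using \<Lambda>c by (simp_all add: h_def h'_def abs_diag_powr_eq)
  have hh: "h * h = mat_diag d (\<lambda>i. \<bar>\<Lambda> $$ (i, i)\<bar>)"
    unfolding h_def abs_diag_powr_eq[OF \<Lambda>c] mat_diag_diag by (rule mat_diag_cong) (simp flip: powr_add)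
  have h'h: "h' * h = 1\<^sub>m d"
    unfolding h_def h'_def abs_diag_powr_eq[OF \<Lambda>c] mat_diag_diag mat_diag_one[symmetric]
    by (rule mat_diag_cong) (use nz in \<open>simp flip: powr_add\<close>)
  have hLh: "h * \<Lambda> * h = mat_diag d (\<lambda>i. \<bar>\<Lambda> $$ (i, i)\<bar> * \<Lambda> $$ (i, i))"
  proof -
    have "h * \<Lambda> * h = h * mat_diag d (\<lambda>i. \<Lambda> $$ (i, i)) * h"
      using ordered_diag_eq_mat_diag[OF \<Lambda>] by simp
    also have "\<dots> = mat_diag d (\<lambda>i. (\<bar>\<Lambda> $$ (i, i)\<bar> powr (1/2) * \<bar>\<Lambda> $$ (i, i)\<bar> powr (1/2)) * \<Lambda> $$ (i, i))"
      unfolding h_def abs_diag_powr_eq[OF \<Lambda>c] mat_diag_diag by (rule mat_diag_cong) (simp add: mult_ac)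
    finally show ?thesis by (simp flip: powr_add)
  qed
  define V where "V = E * transpose_mat K * h"
  have V: "V \<in> carrier_mat d d" using E(1) K h by (simp add: V_def)
  have VT: "transpose_mat V = h * K * E"
    unfolding V_def using E(1) ET K h by (simp add: transpose_mult[of _ d d _ d] assoc_mult_mat[of _ d d _ d _ d])
  have "V * transpose_mat V = E * (transpose_mat K * (h * h) * K) * E"
    unfolding VT unfolding V_def using E(1) K h by (simp add: assoc_mult_mat[of _ d d _ d _ d])
  also have "\<dots> = (E * D) * (D * E)"
    unfolding hh K1 D(3)[symmetric] using E(1) D(1) by (simp add: assoc_mult_mat[of _ d d _ d _ d])
  also have "\<dots> = 1\<^sub>m d" using E by simp
  finally have "transpose_mat V * V = 1\<^sub>m d"
    using V mat_mult_left_right_inverse[of V d "transpose_mat V"] by simp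
  moreover have "V * \<Lambda> * transpose_mat V = D * J * D"
  proof -
    have "V * \<Lambda> * transpose_mat V = E * (transpose_mat K * (h * \<Lambda> * h) * K) * E"
      unfolding VT unfolding V_def using E(1) K h \<Lambda>c by (simp add: assoc_mult_mat[of _ d d _ d _ d])
    also have "\<dots> = (E * D) * (D * J * D) * (D * E)"
      unfolding hLh K2 D(3)[symmetric] using E(1) D(1) J by (simp add: assoc_mult_mat[of _ d d _ d _ d])
    finally show ?thesis using E(2,3) D(1) J by simp
  qed
  ultimately have "eigenvector_mat (D * J * D) \<Lambda> V"
    using V D(1) J by (simp add: eigenvector_mat_def orthonormal_cols_def)
  moreover have "h' * transpose_mat V * D = K"
  proof -
    have "h' * transpose_mat V * D = (h' * h) * K * (E * D)"
      unfolding VT using E(1) K h D(1) by (simp add: assoc_mult_mat[of _ d d _ d _ d])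
    then show ?thesis unfolding h'h E using K by simp
  qed
  ultimately show ?thesis unfolding h'_def by metis
qed

section \<open>Orthogonal matrices commuting with the eigenvalues\<close>

text \<open>With closure under products, proved next, this makes the sequence
  \<open>transpose_mat R * W n\<close> as admissible as \<open>W n\<close> when \<open>V\<close> is
  exchanged for \<open>V * R\<close>.\<close>

lemma block_orthogonal_transpose:
  assumes "\<Lambda> \<in> carrier_mat d d" "transpose_mat \<Lambda> = \<Lambda>" "block_orthogonal \<Lambda> R"
  shows "block_orthogonal \<Lambda> (transpose_mat R)"
proof -
  have orth: "orthonormal_cols d d R" and comm: "R * \<Lambda> = \<Lambda> * R"
    using assms(1,3) by (auto simp: block_orthogonal_def)
  note R = orthonormal_colsD[OF orth]
  have "transpose_mat R * \<Lambda> = \<Lambda> * transpose_mat R"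
    using arg_cong[OF comm, of transpose_mat] R(1) assms(1,2) by (simp add: transpose_mult[of _ d d _ d])
  then show ?thesis using R assms(1) by (simp add: block_orthogonal_def orthonormal_cols_def)
qed

lemma block_orthogonal_mult:
  assumes \<Lambda>: "\<Lambda> \<in> carrier_mat d d" and "block_orthogonal \<Lambda> R" "block_orthogonal \<Lambda> S"
  shows "block_orthogonal \<Lambda> (R * S)"
proof -
  have orth: "orthonormal_cols d d R" "orthonormal_cols d d S"
    and comm: "R * \<Lambda> = \<Lambda> * R" "S * \<Lambda> = \<Lambda> * S"
    using assms by (auto simp: block_orthogonal_def)
  note R = orthonormal_colsD[OF orth(1)] and S = orthonormal_colsD[OF orth(2)]
  have "transpose_mat (R * S) * (R * S) = transpose_mat S * ((transpose_mat R * R) * S)"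
    using R(1) S(1) by (simp add: transpose_mult[of _ d d _ d] assoc_mult_mat[of _ d d _ d _ d])
  also have "\<dots> = 1\<^sub>m d" using R S by simp
  finally have "orthonormal_cols d d (R * S)" using R(1) S(1) by (simp add: orthonormal_cols_def)
  moreover have "R * S * \<Lambda> = \<Lambda> * (R * S)"
  proof -
    have "R * S * \<Lambda> = R * (S * \<Lambda>)" using R(1) S(1) \<Lambda> by (intro assoc_mult_mat[of _ d d _ d _ d])
    also have "\<dots> = (R * \<Lambda>) * S" unfolding comm(2) using R(1) S(1) \<Lambda> by (intro assoc_mult_mat[symmetric, of _ d d _ d _ d])
    also have "\<dots> = \<Lambda> * (R * S)" unfolding comm(1) using R(1) S(1) \<Lambda> by (intro assoc_mult_mat[of _ d d _ d _ d])
    finally show ?thesis .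
  qed
  ultimately show ?thesis using \<Lambda> by (simp add: block_orthogonal_def)
qed

text \<open>The only candidate is \<open>R = V\<^sup>T V'\<close>. Evaluating
  \<open>V\<^sup>T A V'\<close> with either decomposition of \<open>A\<close> gives
  \<open>R \<Lambda> = \<Lambda> R\<close>.\<close>

lemma eigenvector_mat_unique_iff:
  assumes A: "A \<in> carrier_mat d d" and \<Lambda>: "\<Lambda> \<in> carrier_mat d d" and V: "eigenvector_mat A \<Lambda> V"
  shows "eigenvector_mat A \<Lambda> V' \<longleftrightarrow> (\<exists>R. block_orthogonal \<Lambda> R \<and> V' = V * R)"
proof -
  have Vo: "orthonormal_cols d d V" and AV: "A = V * \<Lambda> * transpose_mat V"
    using V A by (auto simp: eigenvector_mat_def)
  note Vd = orthonormal_colsD[OF Vo]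
  show ?thesis
  proof
    assume "eigenvector_mat A \<Lambda> V'"
    then have V'o: "orthonormal_cols d d V'" and AV': "A = V' * \<Lambda> * transpose_mat V'"
      using A by (auto simp: eigenvector_mat_def)
    note V'd = orthonormal_colsD[OF V'o]
    define R where "R = transpose_mat V * V'"
    have Rc: "R \<in> carrier_mat d d" using Vd V'd by (simp add: R_def)
    have "transpose_mat R * R = transpose_mat V' * ((V * transpose_mat V) * V')"
      unfolding R_def using Vd(1) V'd(1) by (simp add: transpose_mult[of _ d d _ d] assoc_mult_mat[of _ d d _ d _ d])
    also have "\<dots> = 1\<^sub>m d" using Vd V'd by simp
    finally have "orthonormal_cols d d R" using Rc by (simp add: orthonormal_cols_def)
    moreover have "R * \<Lambda> = \<Lambda> * R"
    proof -
      have "R * \<Lambda> = transpose_mat V * (V' * \<Lambda> * (transpose_mat V' * V'))"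
        unfolding V'd(2) R_def using Vd(1) V'd(1) \<Lambda> by (simp add: assoc_mult_mat[of _ d d _ d _ d])
      also have "\<dots> = transpose_mat V * A * V'"
        unfolding AV' using Vd(1) V'd(1) \<Lambda> by (simp add: assoc_mult_mat[of _ d d _ d _ d])
      also have "\<dots> = (transpose_mat V * V) * \<Lambda> * (transpose_mat V * V')"
        unfolding AV using Vd(1) V'd(1) \<Lambda> by (simp add: assoc_mult_mat[of _ d d _ d _ d])
      finally show ?thesis using Vd(2) \<Lambda> by (simp add: R_def)
    qed
    moreover have "V * R = V'"
    proof -
      have "V * R = (V * transpose_mat V) * V'"
        unfolding R_def using Vd(1) V'd(1) by (simp add: assoc_mult_mat[of _ d d _ d _ d])
      then show ?thesis using Vd V'd by simp
    qed
    ultimately show "\<exists>R. block_orthogonal \<Lambda> R \<and> V' = V * R"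
      using \<Lambda> by (auto simp: block_orthogonal_def)
  next
    assume "\<exists>R. block_orthogonal \<Lambda> R \<and> V' = V * R"
    then obtain R where "orthonormal_cols d d R" and comm: "R * \<Lambda> = \<Lambda> * R" and V': "V' = V * R"
      using \<Lambda> by (auto simp: block_orthogonal_def)
    note R = orthonormal_colsD[OF this(1)]
    have "transpose_mat V' * V' = transpose_mat R * ((transpose_mat V * V) * R)"
      unfolding V' using Vd(1) R(1) by (simp add: transpose_mult[of _ d d _ d] assoc_mult_mat[of _ d d _ d _ d])
    also have "\<dots> = 1\<^sub>m d" using Vd R by simp
    finally have "orthonormal_cols d d V'" using V' Vd R by (simp add: orthonormal_cols_def)
    moreover have "V' * \<Lambda> * transpose_mat V' = A"
    proof -
      have "V' * \<Lambda> * transpose_mat V' = V * ((R * \<Lambda>) * (transpose_mat R * transpose_mat V))"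
        unfolding V' using Vd(1) R(1) \<Lambda> by (simp add: transpose_mult[of _ d d _ d] assoc_mult_mat[of _ d d _ d _ d])
      also have "\<dots> = V * (\<Lambda> * ((R * transpose_mat R) * transpose_mat V))"
        unfolding comm using Vd(1) R(1) \<Lambda> by (simp add: assoc_mult_mat[of _ d d _ d _ d])
      also have "\<dots> = A" unfolding R(3) AV using Vd(1) \<Lambda> by (simp add: assoc_mult_mat[of _ d d _ d _ d])
      finally show ?thesis .
    qed
    ultimately show "eigenvector_mat A \<Lambda> V'" using A by (simp add: eigenvector_mat_def)
  qed
qed

text \<open>Commuting with distinct diagonal entries forces \<open>R\<close> to be diagonal, and
  orthogonality makes its entries 1 or -1. Conversely, two equal entries can be swapped by a
  permutation matrix, which commutes with \<open>\<Lambda>\<close> without being diagonal.\<close>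

lemma inj_diag_iff_block_orthogonal_sign:
  assumes \<Lambda>: "ordered_diag d \<Lambda>"
  shows "inj_on (\<lambda>i. \<Lambda> $$ (i, i)) {..<d} \<longleftrightarrow> (\<forall>R. block_orthogonal \<Lambda> R \<longrightarrow> sign_mat d R)"
proof
  have \<Lambda>c: "\<Lambda> \<in> carrier_mat d d" using \<Lambda> by (simp add: ordered_diag_def)
  have \<Lambda>d: "\<Lambda> = mat_diag d (\<lambda>i. \<Lambda> $$ (i, i))" by (rule ordered_diag_eq_mat_diag[OF \<Lambda>])
  have comm_iff: "R * \<Lambda> = \<Lambda> * R \<longleftrightarrow> (\<forall>i<d. \<forall>j<d. R $$ (i, j) * \<Lambda> $$ (j, j) = \<Lambda> $$ (i, i) * R $$ (i, j))"
    if R: "R \<in> carrier_mat d d" for R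
  proof -
    have 1: "R * \<Lambda> = mat d d (\<lambda>(i, j). R $$ (i, j) * \<Lambda> $$ (j, j))"
      by (subst \<Lambda>d) (simp add: mat_diag_mult_right[OF R])
    have 2: "\<Lambda> * R = mat d d (\<lambda>(i, j). \<Lambda> $$ (i, i) * R $$ (i, j))"
      by (subst \<Lambda>d) (simp add: mat_diag_mult_left[OF R])
    show ?thesis unfolding 1 2 by (auto simp: mat_eq_iff)
  qed
  show "\<forall>R. block_orthogonal \<Lambda> R \<longrightarrow> sign_mat d R" if inj: "inj_on (\<lambda>i. \<Lambda> $$ (i, i)) {..<d}"
  proof (intro allI impI)
    fix R assume "block_orthogonal \<Lambda> R"
    then have orth: "orthonormal_cols d d R" and "R * \<Lambda> = \<Lambda> * R"
      using \<Lambda>c by (auto simp: block_orthogonal_def)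
    note R = orthonormal_colsD[OF orth]
    have off: "R $$ (i, j) = 0" if "i < d" "j < d" "i \<noteq> j" for i j
    proof -
      have "R $$ (i, j) * \<Lambda> $$ (j, j) = \<Lambda> $$ (i, i) * R $$ (i, j)"
        using comm_iff[OF R(1)] \<open>R * \<Lambda> = \<Lambda> * R\<close> that by blast
      moreover have "\<Lambda> $$ (i, i) \<noteq> \<Lambda> $$ (j, j)" using inj that by (auto dest: inj_onD)
      ultimately show ?thesis by (auto simp: mult.commute)
    qed
    have Rd: "R = mat_diag d (\<lambda>i. R $$ (i, i))"
      using R(1) off by (intro eq_matI) (auto simp: mat_diag_def)
    have "\<forall>i<d. R $$ (i, i) \<in> {1, -1}"
    proof (intro allI impI)
      fix i assume i: "i < d"
      have "transpose_mat R * R = mat_diag d (\<lambda>i. R $$ (i, i) * R $$ (i, i))"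
        by (subst (1 2) Rd) simp
      then have "mat_diag d (\<lambda>i. R $$ (i, i) * R $$ (i, i)) = 1\<^sub>m d" using R(2) by simp
      from arg_cong[OF this, of "\<lambda>M. M $$ (i, i)"] have "R $$ (i, i) * R $$ (i, i) = 1"
        using i by (simp add: mat_diag_def)
      then show "R $$ (i, i) \<in> {1, -1}" by (simp add: square_eq_1_iff)
    qed
    then show "sign_mat d R"
      unfolding sign_mat_def by (intro exI[of _ "\<lambda>i. R $$ (i, i)"] conjI Rd)
  qed
  show "inj_on (\<lambda>i. \<Lambda> $$ (i, i)) {..<d}" if sgn: "\<forall>R. block_orthogonal \<Lambda> R \<longrightarrow> sign_mat d R"
  proof (rule inj_onI, rule ccontr)
    fix i j assume ij: "i \<in> {..<d}" "j \<in> {..<d}" "\<Lambda> $$ (i, i) = \<Lambda> $$ (j, j)" "i \<noteq> j"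
    define f where "f k = (if k = i then j else if k = j then i else k)" for k
    have f: "f k < d" "\<Lambda> $$ (f k, f k) = \<Lambda> $$ (k, k)" "f k = f l \<longleftrightarrow> k = l" if "k < d" for k l
      using that ij by (auto simp: f_def)
    define R where "R = mat d d (\<lambda>(a, b). if a = f b then 1 else 0 :: real)"
    have R: "R \<in> carrier_mat d d" by (simp add: R_def)
    have "transpose_mat R * R = 1\<^sub>m d"
    proof (rule eq_matI)
      fix a b assume "a < dim_row (1\<^sub>m d :: real mat)" "b < dim_col (1\<^sub>m d :: real mat)"
      then have ab: "a < d" "b < d" by auto
      have "(transpose_mat R * R) $$ (a, b) = (\<Sum>k<d. R $$ (k, a) * R $$ (k, b))"
        using ab R by (subst mult_mat_index[of _ d d _ d]) auto
      also have "\<dots> = (\<Sum>k<d. if k = f a then (if a = b then 1 else 0) else 0)"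
        by (rule sum.cong) (use ab f(3)[of a b] in \<open>auto simp: R_def\<close>)
      also have "\<dots> = (if a = b then 1 else 0)" using f(1)[OF ab(1)] by simp
      finally show "(transpose_mat R * R) $$ (a, b) = (1\<^sub>m d :: real mat) $$ (a, b)" using ab by simp
    qed (use R in auto)
    moreover have "R * \<Lambda> = \<Lambda> * R"
      unfolding comm_iff[OF R] using f(2) by (auto simp: R_def)
    ultimately have "sign_mat d R" using sgn R \<Lambda>c by (auto simp: block_orthogonal_def orthonormal_cols_def)
    then obtain s where "R = mat_diag d s" by (auto simp: sign_mat_def)
    from arg_cong[OF this, of "\<lambda>M. M $$ (i, j)"] show False using ij by (simp add: R_def f_def mat_diag_def)
  qed
qed

section \<open>Data matrices\<close>

lemma data_mat_carrier: "data_mat d X n \<omega> \<in> carrier_mat n d"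
  by (auto simp: data_mat_def)

lemma data_mat_gram_index:
  assumes "i < d" "j < d"
  shows "(transpose_mat (data_mat d X n \<omega>) * data_mat d X n \<omega>) $$ (i, j) = (\<Sum>k<n. X k \<omega> $ i * X k \<omega> $ j)"
proof -
  have X: "data_mat d X n \<omega> \<in> carrier_mat n d" by (rule data_mat_carrier)
  have "data_mat d X n \<omega> $$ (k, l) = X k \<omega> $ l" if "k < n" "l < d" for k l
    using that by (simp add: data_mat_def mat_of_rows_index)
  then show ?thesis
    using X assms by (subst mult_mat_index[of _ d n _ d]) (auto intro!: sum.cong)
qed

lemma mat_lim_gram:
  assumes \<Delta>: "\<Delta> \<in> carrier_mat d d"
    and lim: "\<forall>i<d. \<forall>j<d.
      (\<lambda>n. (\<Sum>k<n. X k \<omega> $ i * X k \<omega> $ j) / n) \<longlonglongrightarrow> \<Delta> $$ (i, j)"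
  shows "mat_lim d (\<lambda>n. (1 / real n) \<cdot>\<^sub>m (transpose_mat (data_mat d X n \<omega>) * data_mat d X n \<omega>)) \<Delta>"
  unfolding mat_lim_def
proof (intro conjI allI impI)
  have G: "transpose_mat (data_mat d X n \<omega>) * data_mat d X n \<omega> \<in> carrier_mat d d" for n
    using data_mat_carrier[of d X n \<omega>] by (simp add: mult_carrier_mat[of _ d n _ d])
  then show "(1 / real n) \<cdot>\<^sub>m (transpose_mat (data_mat d X n \<omega>) * data_mat d X n \<omega>) \<in> carrier_mat d d" for n
    by simp
  fix i j assume ij: "i < d" "j < d"
  have "((1 / real n) \<cdot>\<^sub>m (transpose_mat (data_mat d X n \<omega>) * data_mat d X n \<omega>)) $$ (i, j)
      = (\<Sum>k<n. X k \<omega> $ i * X k \<omega> $ j) / n" for n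
    using ij carrier_matD[OF G[of n]] data_mat_gram_index[OF ij, of X n \<omega>] by (simp del: index_mult_mat(1))
  then show "(\<lambda>n. ((1 / real n) \<cdot>\<^sub>m (transpose_mat (data_mat d X n \<omega>) * data_mat d X n \<omega>)) $$ (i, j)) \<longlonglongrightarrow> \<Delta> $$ (i, j)"
    using lim ij by simp
qed (rule \<Delta>)

text \<open>The determinant of the scaled Gram matrix tends to \<open>det \<Delta>\<close>. This
  discharges the rank condition that guards \<open>embedding_alignment\<close> for all large
  \<open>n\<close>.\<close>

lemma eventually_full_rank:
  assumes \<Delta>: "\<Delta> \<in> carrier_mat d d" "det \<Delta> \<noteq> 0"
    and lim: "\<forall>i<d. \<forall>j<d.
      (\<lambda>n. (\<Sum>k<n. X k \<omega> $ i * X k \<omega> $ j) / n) \<longlonglongrightarrow> \<Delta> $$ (i, j)"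
  shows "eventually (\<lambda>n. vec_space.rank (dim_row (data_mat d X n \<omega>)) (data_mat d X n \<omega>) = d) sequentially"
proof -
  have G: "transpose_mat (data_mat d X n \<omega>) * data_mat d X n \<omega> \<in> carrier_mat d d" for n
    using data_mat_carrier[of d X n \<omega>] by (simp add: mult_carrier_mat[of _ d n _ d])
  have "eventually (\<lambda>n. det ((1 / real n) \<cdot>\<^sub>m (transpose_mat (data_mat d X n \<omega>) * data_mat d X n \<omega>)) \<noteq> 0) sequentially"
    by (rule tendsto_imp_eventually_ne[OF mat_lim_det[OF mat_lim_gram[where X = X and \<omega> = \<omega>, OF \<Delta>(1) lim]] \<Delta>(2)])
  then show ?thesis
  proof (rule eventually_mono)
    fix n assume "det ((1 / real n) \<cdot>\<^sub>m (transpose_mat (data_mat d X n \<omega>) * data_mat d X n \<omega>)) \<noteq> 0"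
    then have "det (transpose_mat (data_mat d X n \<omega>) * data_mat d X n \<omega>) \<noteq> 0"
      by auto
    from rank_eq_of_det_gram[OF data_mat_carrier this]
    show "vec_space.rank (dim_row (data_mat d X n \<omega>)) (data_mat d X n \<omega>) = d"
      using data_mat_carrier[of d X n \<omega>] by simp
  qed
qed

text \<open>Only the Gram matrix and the eigenvalues are divided by the sample size.
  \<open>Q\<close> stays as it is, since one Gram identity is homogeneous in the eigenvalues and the
  other sees only their signs.\<close>

lemma alignment_limit:
  assumes d: "d = p + q" and \<Delta>: "\<Delta> \<in> carrier_mat d d" "det \<Delta> \<noteq> 0"
    and lim: "\<forall>i<d. \<forall>j<d.
      (\<lambda>n. (\<Sum>k<n. X k \<omega> $ i * X k \<omega> $ j) / n) \<longlonglongrightarrow> \<Delta> $$ (i, j)"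
    and al: "\<And>n. embedding_alignment p q (data_mat d X n \<omega>) (U n) (L n) (Q n)"
    and \<Lambda>: "ordered_diag d \<Lambda>" "char_poly (sig_mat p q * \<Delta>) = (\<Prod>i<d. [:- \<Lambda> $$ (i, i), 1:])"
    and W: "\<And>n. block_orthogonal \<Lambda> (W n)" and K: "K \<in> carrier_mat d d"
    and WQ: "\<forall>i<d. \<forall>j<d. (\<lambda>n. (W n * Q n) $$ (i, j)) \<longlonglongrightarrow> K $$ (i, j)"
  shows "transpose_mat K * mat_diag d (\<lambda>i. \<bar>\<Lambda> $$ (i, i)\<bar>) * K = \<Delta>"
    and "transpose_mat K * mat_diag d (\<lambda>i. \<bar>\<Lambda> $$ (i, i)\<bar> * \<Lambda> $$ (i, i)) * K = \<Delta> * sig_mat p q * \<Delta>"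
proof -
  let ?X = "\<lambda>n. data_mat d X n \<omega>" and ?J = "sig_mat p q"
  have J: "?J \<in> carrier_mat d d" by (simp add: d)
  have \<Lambda>c: "\<Lambda> \<in> carrier_mat d d" using \<Lambda>(1) by (simp add: ordered_diag_def)
  obtain N0 where N0: "\<And>n. n \<ge> N0 \<Longrightarrow> vec_space.rank (dim_row (?X n)) (?X n) = d"
    using eventually_full_rank[where X = X and \<omega> = \<omega>, OF \<Delta> lim] by (auto simp: eventually_sequentially)
  \<comment> \<open>\<open>Suc\<close> keeps \<open>n + N\<close> positive, so division by it
    preserves signs and nonvanishing of the eigenvalues already at \<open>n = 0\<close>.\<close>
  define N where "N = Suc N0"
  define G where "G n = (1 / real (n + N)) \<cdot>\<^sub>m (transpose_mat (?X (n + N)) * ?X (n + N))" for n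
  define l where "l n i = L (n + N) $$ (i, i) / real (n + N)" for n i
  have dec: "nonzero_eigendecomposition d (?X (n + N) * ?J * transpose_mat (?X (n + N))) (U (n + N)) (L (n + N))"
    and Q: "Q (n + N) \<in> carrier_mat d d"
    and UQ: "U (n + N) * abs_diag_powr (L (n + N)) (1/2) * Q (n + N) = ?X (n + N)" for n
    using al[of "n + N"] N0[of "n + N"] by (auto simp: embedding_alignment_def N_def d)
  note ids = embedding_gram_identities[OF data_mat_carrier J dec Q UQ]
  have pos: "real (n + N) > 0" for n by (simp add: N_def)
  have G_lim: "mat_lim d G \<Delta>"
    unfolding G_def using mat_lim_subseq[OF mat_lim_gram[where X = X and \<omega> = \<omega>, OF \<Delta>(1) lim], of "\<lambda>n. n + N"]
    by (simp add: strict_mono_def)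
  have od: "ordered_diag d (mat_diag d (l n))" for n
    using dec[of n] by (auto simp: nonzero_eigendecomposition_def ordered_diag_def l_def mat_diag_def
        diagonal_mat_def intro!: divide_right_mono)
  have nz: "mat_diag d (l n) $$ (i, i) \<noteq> 0" if "i < d" for n i
    using dec[of n] that pos[of n] by (auto simp: nonzero_eigendecomposition_def l_def mat_diag_def)
  have QJ: "Q (n + N) * ?J * transpose_mat (Q (n + N)) = mat_diag d (\<lambda>i. sgn (mat_diag d (l n) $$ (i, i)))" for n
    unfolding ids(1) by (rule mat_diag_cong) (use pos[of n] in \<open>simp add: l_def mat_diag_def\<close>)
  have QG: "transpose_mat (Q (n + N)) * mat_diag d (\<lambda>i. \<bar>mat_diag d (l n) $$ (i, i)\<bar>) * Q (n + N) = G n" for n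
  proof -
    have "mat_diag d (\<lambda>i. \<bar>mat_diag d (l n) $$ (i, i)\<bar>) = (1 / real (n + N)) \<cdot>\<^sub>m mat_diag d (\<lambda>i. \<bar>L (n + N) $$ (i, i)\<bar>)"
      using pos[of n] by (auto simp: mat_diag_def l_def)
    then show ?thesis
      unfolding G_def ids(2)[symmetric] using Q[of n]
      by (simp add: mult_smult_distrib[of _ d d _ d] mult_smult_assoc_mat[of _ d d _ d])
  qed
  have "mat_lim d (\<lambda>n. W (n + N) * Q (n + N)) K"
    unfolding mat_lim_def
  proof (intro conjI allI impI)
    show "W (n + N) * Q (n + N) \<in> carrier_mat d d" for n
      using W[of "n + N"] Q[of n] \<Lambda>c by (simp add: block_orthogonal_def orthonormal_cols_def)
    show "(\<lambda>n. (W (n + N) * Q (n + N)) $$ (i, j)) \<longlonglongrightarrow> K $$ (i, j)" if "i < d" "j < d" for i j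
      using LIMSEQ_ignore_initial_segment[of "\<lambda>n. (W n * Q n) $$ (i, j)" _ N] WQ that by simp
  qed (rule K)
  from embedding_limit[OF J G_lim \<Delta>(2) od nz Q QJ QG \<Lambda> W this]
  show "transpose_mat K * mat_diag d (\<lambda>i. \<bar>\<Lambda> $$ (i, i)\<bar>) * K = \<Delta>"
    and "transpose_mat K * mat_diag d (\<lambda>i. \<bar>\<Lambda> $$ (i, i)\<bar> * \<Lambda> $$ (i, i)) * K = \<Delta> * ?J * \<Delta>" by auto
qed

text \<open>A sign matrix is its own inverse and commutes with diagonal matrices, so the two copies
  of \<open>S\<close> cancel across \<open>L\<close> and its powers. Changing signs of eigenvectors
  therefore amounts to replacing \<open>Q\<close> by \<open>S * Q\<close>.\<close>

lemma embedding_alignment_sign: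
  assumes A: "dim_col A = p + q" and S: "sign_mat (p + q) S" and al: "embedding_alignment p q A U L Q"
  shows "embedding_alignment p q A (U * S) L (S * Q)"
  unfolding embedding_alignment_def
proof (intro impI)
  define d where "d = p + q"
  assume "vec_space.rank (dim_row A) A = p + q"
  then have dec: "nonzero_eigendecomposition d (A * sig_mat p q * transpose_mat A) U L"
    and Q: "Q \<in> carrier_mat d d" and UQ: "U * abs_diag_powr L (1/2) * Q = A"
    using al by (auto simp: embedding_alignment_def d_def)
  define n where "n = dim_row A"
  have U: "U \<in> carrier_mat n d" "transpose_mat U * U = 1\<^sub>m d" and L: "ordered_diag d L"
    and nz: "\<forall>i<d. L $$ (i, i) \<noteq> 0" and P: "A * sig_mat p q * transpose_mat A = U * L * transpose_mat U"
    using dec by (auto simp: nonzero_eigendecomposition_def orthonormal_cols_def n_def)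
  have Lc: "L \<in> carrier_mat d d" using L by (simp add: ordered_diag_def)
  obtain s where s: "\<And>i. i < d \<Longrightarrow> s i \<in> {1, -1}" and Ss: "S = mat_diag d s"
    using S by (auto simp: sign_mat_def d_def)
  have Sc: "S \<in> carrier_mat d d" "transpose_mat S = S" by (simp_all add: Ss)
  have sandwich: "S * (mat_diag d f * S) = mat_diag d f" for f
    unfolding Ss mat_diag_diag by (rule mat_diag_cong) (use s in force)
  have SS: "S * S = 1\<^sub>m d" using sandwich[of "\<lambda>_. 1"] Sc by simp
  have SLS: "S * (L * S) = L" using sandwich[of "\<lambda>i. L $$ (i, i)"] ordered_diag_eq_mat_diag[OF L] by simp
  have SbS: "S * (abs_diag_powr L (1/2) * S) = abs_diag_powr L (1/2)"
    unfolding abs_diag_powr_eq[OF Lc] by (rule sandwich)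
  have b: "abs_diag_powr L (1/2) \<in> carrier_mat d d" using Lc by (rule abs_diag_powr_carrier)
  have US: "U * S \<in> carrier_mat n d" using U Sc by (simp add: mult_carrier_mat[of _ n d _ d])
  have "transpose_mat (U * S) * (U * S) = S * ((transpose_mat U * U) * S)"
    using U(1) Sc by (simp add: transpose_mult[of _ n d _ d] assoc_mult_mat[of _ d d _ n _ d]
        assoc_mult_mat[of _ d n _ d _ d] mult_carrier_mat[of _ n d _ d])
  also have "\<dots> = 1\<^sub>m d" using U(2) Sc SS by simp
  finally have orth: "orthonormal_cols n d (U * S)" using US by (simp add: orthonormal_cols_def)
  have "U * S * L * transpose_mat (U * S) = U * (S * (L * S)) * transpose_mat U"
    using U(1) Sc Lc by (simp add: transpose_mult[of _ n d _ d] assoc_mult_mat[of _ n d _ d _ d]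
        assoc_mult_mat[of _ n d _ d _ n] assoc_mult_mat[of _ d d _ d _ d] assoc_mult_mat[of _ d d _ d _ n]
        mult_carrier_mat[of _ d d _ n])
  also have "\<dots> = A * sig_mat p q * transpose_mat A" unfolding SLS P ..
  finally have eig: "A * sig_mat p q * transpose_mat A = U * S * L * transpose_mat (U * S)" ..
  have "U * S * abs_diag_powr L (1/2) * (S * Q) = U * (S * (abs_diag_powr L (1/2) * S)) * Q"
    using U(1) Sc b Q by (simp add: assoc_mult_mat[of _ n d _ d _ d] assoc_mult_mat[of _ d d _ d _ d])
  then have emb: "U * S * abs_diag_powr L (1/2) * (S * Q) = A" unfolding SbS UQ .
  have dim: "dim_row (A * sig_mat p q * transpose_mat A) = n" by (simp add: n_def)
  show "nonzero_eigendecomposition (p + q) (A * sig_mat p q * transpose_mat A) (U * S) L \<and>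
      S * Q \<in> carrier_mat (p + q) (p + q) \<and> U * S * abs_diag_powr L (1/2) * (S * Q) = A"
    unfolding nonzero_eigendecomposition_def dim d_def[symmetric]
    using orth L nz eig emb square_mult_carrier[OF Sc(1) Q] by blast
qed

text \<open>The second conjunct makes "up to the choice of V" precise: every choice gives a limiting
  matrix again, and any two choices differ by a block-orthogonal factor. The third ties this freedom
  to repeated eigenvalues, since for distinct ones only column signs remain. The fourth is the case
  of distinct eigenvalues, where suitable eigenvector signs make the alignment itself
  converge.\<close>

theorem corollary2:
  fixes p q d :: nat
    and M :: "'w measure" and F :: "real vec measure" and X :: "nat \<Rightarrow> 'w \<Rightarrow> real vec"
    and U \<Lambda> Q :: "nat \<Rightarrow> 'w \<Rightarrow> real mat"
    and \<Delta> D A \<Lambda>t Qt :: "real mat"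
  assumes "d = p + q"
    and "\<Delta> = second_moment_mat d F"
    and "D = psd_sqrt \<Delta>"
    and "A = D * sig_mat p q * D"
    and "gen_inner_product_distribution p q F"
    and "prob_space M"
    and "prob_space.indep_vars M (\<lambda>_. vec_borel d) X UNIV"
    and "\<And>i. distr M (vec_borel d) (X i) = F"
    and "has_second_moments d F"
    and "vec_space.rank d (\<Delta> * sig_mat p q) = d"
    and "\<And>n \<omega>. \<omega> \<in> space M \<Longrightarrow>
           embedding_alignment p q (data_mat d X n \<omega>) (U n \<omega>) (\<Lambda> n \<omega>) (Q n \<omega>)"
    and "eigenvalue_mat A \<Lambda>t"
    and "limiting_matrix M \<Lambda>t Q Qt"
  shows "(\<exists>V. eigenvector_mat A \<Lambda>t V \<and> Qt = abs_diag_powr \<Lambda>t (-1/2) * transpose_mat V * D) \<and>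
    (\<forall>V. eigenvector_mat A \<Lambda>t V \<longrightarrow>
       limiting_matrix M \<Lambda>t Q (abs_diag_powr \<Lambda>t (-1/2) * transpose_mat V * D) \<and>
       (\<forall>V'. eigenvector_mat A \<Lambda>t V' \<longleftrightarrow> (\<exists>R. block_orthogonal \<Lambda>t R \<and> V' = V * R))) \<and>
    (card {k. eigenvalue (\<Delta> * sig_mat p q) k} = d \<longleftrightarrow>
       (\<forall>R. block_orthogonal \<Lambda>t R \<longrightarrow> sign_mat d R)) \<and>
    (card {k. eigenvalue (\<Delta> * sig_mat p q) k} = d \<longrightarrow>
       (\<exists>S Q'. (\<forall>n. \<forall>\<omega>\<in>space M. sign_mat d (S n \<omega>) \<and>
                  embedding_alignment p q (data_mat d X n \<omega>) (U n \<omega> * S n \<omega>) (\<Lambda> n \<omega>) (Q' n \<omega>)) \<and>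
               as_limit M Q' Qt))"
proof -
  note d = assms(1) and \<Delta>_eq = assms(2) and D_eq = assms(3) and A_eq = assms(4)
  interpret prob_space M by (rule assms(6))
  let ?J = "sig_mat p q"
  have J: "?J \<in> carrier_mat d d" by (simp add: d)
  have \<Delta>: "\<Delta> \<in> carrier_mat d d" by (simp add: \<Delta>_eq)
  interpret vs: vec_space "TYPE(real)" d .
  have det_\<Delta>J: "det (\<Delta> * ?J) \<noteq> 0"
    using vs.det_rank_iff[of "\<Delta> * ?J"] assms(10) \<Delta> J by simp
  then have det_\<Delta>: "det \<Delta> \<noteq> 0" using \<Delta> J by (auto simp: det_mult[of _ d])
  have psd: "psd_mat \<Delta>" unfolding \<Delta>_eq by (rule psd_second_moment_mat[OF assms(9)])
  have DD: "D * D = \<Delta>" and psdD: "psd_mat D"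
    using psd_sqrt[OF psd] by (auto simp: D_eq)
  have "dim_row D = d" using arg_cong[OF DD, of dim_row] \<Delta> by simp
  with psdD have D: "D \<in> carrier_mat d d" "transpose_mat D = D" by (auto simp: psd_mat_def)
  have det_D: "det D \<noteq> 0" using det_\<Delta> D(1) by (auto simp: det_mult[of _ d] simp flip: DD)
  have A: "A \<in> carrier_mat d d" using D(1) J by (simp add: A_eq)
  have \<Lambda>: "ordered_diag d \<Lambda>t" and cpA: "char_poly A = (\<Prod>i<d. [:- \<Lambda>t $$ (i, i), 1:])"
    using assms(12) A by (auto simp: eigenvalue_mat_def)
  have \<Lambda>c: "\<Lambda>t \<in> carrier_mat d d" using \<Lambda> by (simp add: ordered_diag_def)
  have \<Lambda>T: "transpose_mat \<Lambda>t = \<Lambda>t"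
    using ordered_diag_eq_mat_diag[OF \<Lambda>] by (metis transpose_mat_diag)
  \<comment> \<open>\<open>D\<close> intertwines \<open>A\<close> with \<open>?J * \<Delta>\<close>
    and, below, \<open>\<Delta> * ?J\<close> with \<open>A\<close>, so all three share a
    characteristic polynomial. The limit of the embedding needs the first product, the count of
    eigenvalues the second.\<close>
  have "A * D = D * (?J * \<Delta>)"
    unfolding A_eq DD[symmetric] using D(1) J by (simp add: assoc_mult_mat[of _ d d _ d _ d])
  from char_poly_intertwined[OF A _ D(1) det_D this] have "char_poly A = char_poly (?J * \<Delta>)"
    using \<Delta> J by simp
  then have cpJ: "char_poly (?J * \<Delta>) = (\<Prod>i<d. [:- \<Lambda>t $$ (i, i), 1:])" using cpA by simp
  have "(\<Delta> * ?J) * D = D * A"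
    unfolding A_eq DD[symmetric] using D(1) J by (simp add: assoc_mult_mat[of _ d d _ d _ d])
  from char_poly_intertwined[OF _ A D(1) det_D this] have "char_poly (\<Delta> * ?J) = char_poly A"
    using \<Delta> J by simp
  then have "eigenvalue (\<Delta> * ?J) k \<longleftrightarrow> (\<exists>i<d. k = \<Lambda>t $$ (i, i))" for k
    using eigenvalue_root_char_poly[of "\<Delta> * ?J" d k] \<Delta> J cpA by (auto simp: poly_prod)
  then have "{k. eigenvalue (\<Delta> * ?J) k} = (\<lambda>i. \<Lambda>t $$ (i, i)) ` {..<d}" by auto
  then have "card {k. eigenvalue (\<Delta> * ?J) k} = d \<longleftrightarrow> inj_on (\<lambda>i. \<Lambda>t $$ (i, i)) {..<d}"
    by (metis card_image card_lessThan eq_card_imp_inj_on finite_lessThan)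
  then have simple: "card {k. eigenvalue (\<Delta> * ?J) k} = d \<longleftrightarrow> (\<forall>R. block_orthogonal \<Lambda>t R \<longrightarrow> sign_mat d R)"
    using inj_diag_iff_block_orthogonal_sign[OF \<Lambda>] by simp

  obtain B where B: "AE x in F. \<forall>i<d. \<bar>x $ i\<bar> \<le> B"
    using gen_inner_product_distribution_bounded[OF assms(5) d assms(9)] det_\<Delta>J \<Delta>_eq by metis
  have lln: "AE \<omega> in M. \<forall>i<d. \<forall>j<d. (\<lambda>n. (\<Sum>k<n. X k \<omega> $ i * X k \<omega> $ j) / n) \<longlonglongrightarrow> \<Delta> $$ (i, j)"
    unfolding \<Delta>_eq by (rule strong_law_second_moments[OF assms(6,7,8) B])
  obtain W where W: "\<And>n \<omega>. \<omega> \<in> space M \<Longrightarrow> block_orthogonal \<Lambda>t (W n \<omega>)"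
    and WQ: "as_limit M (\<lambda>n \<omega>. W n \<omega> * Q n \<omega>) Qt" and Qt: "Qt \<in> carrier_mat d d"
    using assms(13) \<Lambda>c by (auto simp: limiting_matrix_def)
  have WQ_entries: "AE \<omega> in M. \<forall>i<d. \<forall>j<d. (\<lambda>n. (W n \<omega> * Q n \<omega>) $$ (i, j)) \<longlonglongrightarrow> Qt $$ (i, j)"
    using WQ unfolding as_limit_def spectral_norm_tendsto_iff[OF Qt] .

  \<comment> \<open>Otherwise two almost sure events would be disjoint on a probability
    space.\<close>
  have "\<exists>\<omega>\<in>space M. (\<forall>i<d. \<forall>j<d. (\<lambda>n. (\<Sum>k<n. X k \<omega> $ i * X k \<omega> $ j) / n) \<longlonglongrightarrow> \<Delta> $$ (i, j)) \<and>
      (\<forall>i<d. \<forall>j<d. (\<lambda>n. (W n \<omega> * Q n \<omega>) $$ (i, j)) \<longlonglongrightarrow> Qt $$ (i, j))"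
  proof (rule ccontr)
    assume "\<not> ?thesis"
    then have "AE \<omega> in M. False"
      by (intro eventually_mono[OF eventually_conj[OF AE_space[of M] eventually_conj[OF lln WQ_entries]]]) blast
    then show False by simp
  qed
  then obtain \<omega> where \<omega>: "\<omega> \<in> space M"
    and lim\<omega>: "\<forall>i<d. \<forall>j<d. (\<lambda>n. (\<Sum>k<n. X k \<omega> $ i * X k \<omega> $ j) / n) \<longlonglongrightarrow> \<Delta> $$ (i, j)"
    and WQ\<omega>: "\<forall>i<d. \<forall>j<d. (\<lambda>n. (W n \<omega> * Q n \<omega>) $$ (i, j)) \<longlonglongrightarrow> Qt $$ (i, j)"
    by blast
  note gram = alignment_limit[OF d \<Delta> det_\<Delta> lim\<omega> assms(11)[OF \<omega>] \<Lambda> cpJ W[OF \<omega>] Qt WQ\<omega>]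
  obtain V0 where V0: "eigenvector_mat A \<Lambda>t V0" "Qt = abs_diag_powr \<Lambda>t (-1/2) * transpose_mat V0 * D"
    using limit_eigenvector_form[OF D DD det_D J \<Lambda> Qt gram] by (auto simp: A_eq)

  \<comment> \<open>Passing from \<open>V0\<close> to \<open>V0 * R\<close> multiplies the limit by
    \<open>transpose_mat R\<close> on the left, because this factor commutes with the power of
    \<open>\<bar>\<Lambda>t\<bar>\<close>. The sequence \<open>W n\<close> absorbs it.\<close>
  have limiting: "limiting_matrix M \<Lambda>t Q (abs_diag_powr \<Lambda>t (-1/2) * transpose_mat V * D)"
    if V: "eigenvector_mat A \<Lambda>t V" for V
  proof -
    obtain R where R: "block_orthogonal \<Lambda>t R" and VR: "V = V0 * R"
      using eigenvector_mat_unique_iff[OF A \<Lambda>c V0(1)] V by blast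
    have Rc: "R \<in> carrier_mat d d" using R \<Lambda>c by (auto simp: block_orthogonal_def orthonormal_cols_def)
    have V0c: "V0 \<in> carrier_mat d d" using V0(1) A by (auto simp: eigenvector_mat_def orthonormal_cols_def)
    note RT = block_orthogonal_transpose[OF \<Lambda>c \<Lambda>T R]
    define h where "h = abs_diag_powr \<Lambda>t (-1/2)"
    have h: "h \<in> carrier_mat d d" using \<Lambda>c by (simp add: h_def abs_diag_powr_carrier)
    have comm: "transpose_mat R * h = h * transpose_mat R"
    proof -
      have "transpose_mat R * mat_diag d (\<lambda>i. \<Lambda>t $$ (i, i)) = mat_diag d (\<lambda>i. \<Lambda>t $$ (i, i)) * transpose_mat R"
        using RT ordered_diag_eq_mat_diag[OF \<Lambda>] by (simp add: block_orthogonal_def)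
      from commute_mat_diag_fun[OF _ this, of "\<lambda>x. \<bar>x\<bar> powr (-1/2)"] show ?thesis
        using Rc by (simp add: h_def abs_diag_powr_eq[OF \<Lambda>c])
    qed
    have "h * transpose_mat V * D = (h * transpose_mat R) * (transpose_mat V0 * D)"
      unfolding VR using h Rc V0c D(1) by (simp add: transpose_mult[of _ d d _ d] assoc_mult_mat[of _ d d _ d _ d])
    also have "\<dots> = transpose_mat R * Qt"
      unfolding comm[symmetric] V0(2) h_def[symmetric] using h Rc V0c D(1) by (simp add: assoc_mult_mat[of _ d d _ d _ d])
    finally have eq: "h * transpose_mat V * D = transpose_mat R * Qt" .
    have RQc: "transpose_mat R * Qt \<in> carrier_mat d d" using Rc Qt by simp
    have "as_limit M (\<lambda>n \<omega>. transpose_mat R * W n \<omega> * Q n \<omega>) (transpose_mat R * Qt)"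
      unfolding as_limit_def spectral_norm_tendsto_iff[OF RQc]
    proof (rule eventually_mono[OF eventually_conj[OF AE_space[of M] eventually_conj[OF lln WQ_entries]]], elim conjE)
      fix \<omega>
      assume lim: "\<forall>i<d. \<forall>j<d. (\<lambda>n. (\<Sum>k<n. X k \<omega> $ i * X k \<omega> $ j) / n) \<longlonglongrightarrow> \<Delta> $$ (i, j)"
        and WQ: "\<forall>i<d. \<forall>j<d. (\<lambda>n. (W n \<omega> * Q n \<omega>) $$ (i, j)) \<longlonglongrightarrow> Qt $$ (i, j)"
        and \<omega>: "\<omega> \<in> space M"
      show "\<forall>i<d. \<forall>j<d. (\<lambda>n. (transpose_mat R * W n \<omega> * Q n \<omega>) $$ (i, j)) \<longlonglongrightarrow> (transpose_mat R * Qt) $$ (i, j)"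
      proof (intro allI impI)
        fix i j assume ij: "i < d" "j < d"
        have "(\<lambda>n. \<Sum>k<d. transpose_mat R $$ (i, k) * (W n \<omega> * Q n \<omega>) $$ (k, j)) \<longlonglongrightarrow>
            (\<Sum>k<d. transpose_mat R $$ (i, k) * Qt $$ (k, j))"
          by (intro tendsto_sum tendsto_mult tendsto_const) (use WQ ij in auto)
        also have "(\<Sum>k<d. transpose_mat R $$ (i, k) * Qt $$ (k, j)) = (transpose_mat R * Qt) $$ (i, j)"
          using Rc Qt ij by (intro mult_mat_index[symmetric]) auto
        finally have lim': "(\<lambda>n. \<Sum>k<d. transpose_mat R $$ (i, k) * (W n \<omega> * Q n \<omega>) $$ (k, j)) \<longlonglongrightarrow>
            (transpose_mat R * Qt) $$ (i, j)" .
        \<comment> \<open>Reassociating the product needs the dimensions of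
          \<open>Q n \<omega>\<close>, which are known only at full rank. Hence the equality is
          merely eventual, and the law of large numbers enters once more.\<close>
        have "eventually (\<lambda>n. (transpose_mat R * W n \<omega> * Q n \<omega>) $$ (i, j) =
            (\<Sum>k<d. transpose_mat R $$ (i, k) * (W n \<omega> * Q n \<omega>) $$ (k, j))) sequentially"
          using eventually_full_rank[where X = X and \<omega> = \<omega>, OF \<Delta> det_\<Delta> lim]
        proof (rule eventually_mono)
          fix n assume "vec_space.rank (dim_row (data_mat d X n \<omega>)) (data_mat d X n \<omega>) = d"
          then have Qn: "Q n \<omega> \<in> carrier_mat d d"
            using assms(11)[OF \<omega>, of n] by (auto simp: embedding_alignment_def d)
          have Wn: "W n \<omega> \<in> carrier_mat d d"
            using W[OF \<omega>, of n] \<Lambda>c by (auto simp: block_orthogonal_def orthonormal_cols_def)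
          have "transpose_mat R * W n \<omega> * Q n \<omega> = transpose_mat R * (W n \<omega> * Q n \<omega>)"
            using Rc Wn Qn by (simp add: assoc_mult_mat[of _ d d _ d _ d])
          then show "(transpose_mat R * W n \<omega> * Q n \<omega>) $$ (i, j) =
              (\<Sum>k<d. transpose_mat R $$ (i, k) * (W n \<omega> * Q n \<omega>) $$ (k, j))"
            using mult_mat_index[of "transpose_mat R" d d "W n \<omega> * Q n \<omega>" d i j] Rc Wn Qn ij by simp
        qed
        from tendsto_cong[OF this] lim'
        show "(\<lambda>n. (transpose_mat R * W n \<omega> * Q n \<omega>) $$ (i, j)) \<longlonglongrightarrow> (transpose_mat R * Qt) $$ (i, j)" by simp
      qed
    qed
    moreover have "\<forall>n. \<forall>\<omega>\<in>space M. block_orthogonal \<Lambda>t (transpose_mat R * W n \<omega>)"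
      using block_orthogonal_mult[OF \<Lambda>c RT] W by blast
    ultimately have "limiting_matrix M \<Lambda>t Q (transpose_mat R * Qt)"
      unfolding limiting_matrix_def using RQc \<Lambda>c
      by (intro conjI exI[of _ "\<lambda>n \<omega>. transpose_mat R * W n \<omega>"]) simp_all
    then show ?thesis using eq by (simp add: h_def)
  qed

  have signs: "\<exists>S Q'. (\<forall>n. \<forall>\<omega>\<in>space M. sign_mat d (S n \<omega>) \<and>
      embedding_alignment p q (data_mat d X n \<omega>) (U n \<omega> * S n \<omega>) (\<Lambda> n \<omega>) (Q' n \<omega>)) \<and> as_limit M Q' Qt"
    if "card {k. eigenvalue (\<Delta> * ?J) k} = d"
  proof (intro exI conjI allI ballI)
    \<comment> \<open>For distinct eigenvalues \<open>W n \<omega>\<close> is itself a sign matrix,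
      so the witnesses are \<open>W\<close> for \<open>S\<close> and
      \<open>W n \<omega> * Q n \<omega>\<close> for \<open>Q'\<close>; the required convergence is
      then \<open>WQ\<close>.\<close>
    fix n \<omega> assume \<omega>: "\<omega> \<in> space M"
    show sgn: "sign_mat d (W n \<omega>)" using that simple W[OF \<omega>] by blast
    show "embedding_alignment p q (data_mat d X n \<omega>) (U n \<omega> * W n \<omega>) (\<Lambda> n \<omega>) (W n \<omega> * Q n \<omega>)"
      using data_mat_carrier[of d X n \<omega>] sgn assms(11)[OF \<omega>, of n]
      by (intro embedding_alignment_sign) (auto simp: d)
  qed (rule WQ)

  show ?thesis
    using V0 limiting eigenvector_mat_unique_iff[OF A \<Lambda>c] simple signs by blast
qed

end
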